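(* There is a $\mathbb Z^2$-SFT with TCPE rank 3.
   Context: For a finite alphabet $\Delta$, a $\mathbb Z^2$-subshift is a subset $X\subseteq\Delta^{\mathbb Z^2}$ that is topologically closed and shift-invariant; it is a $\mathbb Z^2$-SFT if it is defined by a finite set of forbidden finite patterns. For an open cover $\mathcal U$ of $X$ let $\mathcal U_n=\bigvee_{g\in[0,n)^2}g^{-1}\mathcal U$ (common refinement), let $\mathcal N(\mathcal U_n)$ be the least cardinality of a subcover of $\mathcal U_n$, and $h(X,\mathcal U)=\lim_{n\to\infty}\frac{\log\mathcal N(\mathcal U_n)}{n^2}$. A pair $x\ne y$ in $X$ is an entropy pair if $h(X,\{X\setminus K_x,X\setminus K_y\})>0$ for every pair of disjoint closed neighbourhoods $K_x$ of $x$ and $K_y$ of $y$. Define $E_1=\{(x,y)\in X^2: x=y\text{ or }(x,y)\text{ is an entropy pair}\}$; $E_{\alpha+1}$ is the topological closure of $E_\alpha$ if $E_\alpha$ is not closed, the transitive and symmetric closure of $E_\alpha$ if $E_\alpha$ is closed but not an equivalence relation, and $E_\alpha$ if $E_\alpha$ is a closed equivalence relation; $E_\lambda=\bigcup_{1\le\alpha<\lambda}E_\alpha$ for limit $\lambda$. $X$ has topological completely positive entropy (TCPE: every nontrivial topological factor has positive entropy) if and only if $E_\alpha=X^2$ for some $\alpha$; in that case the TCPE rank of $X$ is the least $\alpha\geq 1$ with $E_\alpha=X^2$. *)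

theory Defs
  imports "HOL-Analysis.Analysis"
begin

text \<open>
  A configuration is a function on the additive group of integer pairs. The topology on
  configurations is the library's product topology; with discrete \<open>'a\<close> and finite \<open>A\<close>, the set
  \<open>UNIV \<rightarrow> A\<close> carries the usual compact topology of the full shift and is closed.
\<close>

type_synonym 'a config = "int \<times> int \<Rightarrow> 'a"

definition shift :: "int \<times> int \<Rightarrow> 'a config \<Rightarrow> 'a config" where
  "shift g x = (\<lambda>h. x (g + h))"

definition subshift :: "'a::discrete_topology set \<Rightarrow> 'a config set \<Rightarrow> bool" where
  "subshift A X \<longleftrightarrow> finite A \<and> X \<subseteq> UNIV \<rightarrow> A \<and> closed X \<and> (\<forall>g. shift g ` X \<subseteq> X)"

type_synonym 'a pattern = "(int \<times> int) \<rightharpoonup> 'a"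

definition finite_pattern :: "'a set \<Rightarrow> 'a pattern \<Rightarrow> bool" where
  "finite_pattern A p \<longleftrightarrow> finite (dom p) \<and> ran p \<subseteq> A"

definition occurs_in :: "'a pattern \<Rightarrow> 'a config \<Rightarrow> bool" where
  "occurs_in p x \<longleftrightarrow> (\<exists>g. \<forall>h\<in>dom p. p h = Some (x (g + h)))"

definition sft :: "'a::discrete_topology set \<Rightarrow> 'a config set \<Rightarrow> bool" where
  "sft A X \<longleftrightarrow> subshift A X \<and>
    (\<exists>F. finite F \<and> (\<forall>p\<in>F. finite_pattern A p) \<and>
         X = {x \<in> UNIV \<rightarrow> A. \<forall>p\<in>F. \<not> occurs_in p x})"

definition window :: "nat \<Rightarrow> (int \<times> int) set" where
  "window n = {0..<int n} \<times> {0..<int n}"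

text \<open>The members of the common refinement of the covers \<open>g\<^sup>-\<^sup>1\<U>\<close>, for \<open>g \<in> [0,n)\<^sup>2\<close>, are the
  intersections formed by choosing one member \<open>c g\<close> of \<open>\<U>\<close> for every \<open>g\<close>.\<close>

definition refined_cover :: "'a config set \<Rightarrow> 'a config set set \<Rightarrow> nat \<Rightarrow> 'a config set set" where
  "refined_cover X \<U> n =
    {X \<inter> (\<Inter>g\<in>window n. shift g -` c g) | c. \<forall>g\<in>window n. c g \<in> \<U>}"

definition min_subcover :: "'b set \<Rightarrow> 'b set set \<Rightarrow> nat" where
  "min_subcover X \<V> = (LEAST k. \<exists>\<W>\<subseteq>\<V>. finite \<W> \<and> X \<subseteq> \<Union>\<W> \<and> card \<W> = k)"

definition cover_entropy :: "'a config set \<Rightarrow> 'a config set set \<Rightarrow> real" where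
  "cover_entropy X \<U> =
    lim (\<lambda>n. ln (real (min_subcover X (refined_cover X \<U> n))) / real n ^ 2)"

definition closed_nbhd :: "'b::topological_space set \<Rightarrow> 'b \<Rightarrow> 'b set \<Rightarrow> bool" where
  "closed_nbhd X x K \<longleftrightarrow> closedin (top_of_set X) K \<and>
    (\<exists>U. openin (top_of_set X) U \<and> x \<in> U \<and> U \<subseteq> K)"

definition entropy_pair :: "'a::discrete_topology config set \<Rightarrow> 'a config \<Rightarrow> 'a config \<Rightarrow> bool" where
  "entropy_pair X x y \<longleftrightarrow> x \<in> X \<and> y \<in> X \<and> x \<noteq> y \<and>
    (\<forall>K L. closed_nbhd X x K \<and> closed_nbhd X y L \<and> K \<inter> L = {} \<longrightarrow>
           cover_entropy X {X - K, X - L} > 0)"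

definition E1 :: "'a::discrete_topology config set \<Rightarrow> 'a config rel" where
  "E1 X = {(x, y) \<in> X \<times> X. x = y \<or> entropy_pair X x y}"

text \<open>Since a subshift \<open>X\<close> is closed, closure and closedness in the ambient product space agree
  with those relative to \<open>X \<times> X\<close> for relations on \<open>X\<close>.\<close>

definition next_E :: "'b::topological_space set \<Rightarrow> 'b rel \<Rightarrow> 'b rel" where
  "next_E X E =
    (if \<not> closed E then closure E
     else if \<not> equiv X E then (E \<union> E\<inverse>)\<^sup>+
     else E)"

text \<open>The hierarchy is indexed by an arbitrary well-ordered type \<open>'o\<close>, whose elements play the role
  of an initial segment of the ordinals. The least element is the ordinal 0, \<open>ord_one\<close> is the
  ordinal 1, and the value at the (unused) index 0 is immaterial. Over \<open>nat\<close>, the element \<open>n\<close> is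
  the ordinal \<open>n\<close>.\<close>

definition ord_one :: "'o::wellorder" where
  "ord_one = (LEAST \<alpha>. \<exists>\<beta>. \<beta> < \<alpha>)"

definition is_pred :: "'o::wellorder \<Rightarrow> 'o \<Rightarrow> bool" where
  "is_pred \<beta> \<alpha> \<longleftrightarrow> \<beta> < \<alpha> \<and> (\<forall>\<gamma><\<alpha>. \<gamma> \<le> \<beta>)"

lemma is_pred_the: "is_pred \<beta> \<alpha> \<Longrightarrow> (THE \<beta>. is_pred \<beta> \<alpha>) = \<beta>"
  unfolding is_pred_def by (intro the_equality) (auto intro: order.antisym)

function E_stage :: "'a::discrete_topology config set \<Rightarrow> 'o::wellorder \<Rightarrow> 'a config rel" where
  "E_stage X \<alpha> =
    (if \<alpha> \<le> ord_one then E1 X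
     else if \<exists>\<beta>. is_pred \<beta> \<alpha> then next_E X (E_stage X (THE \<beta>. is_pred \<beta> \<alpha>))
     else (\<Union>\<beta>\<in>{ord_one..<\<alpha>}. E_stage X \<beta>))"
  by auto
termination
proof (relation "inv_image {(\<beta>, \<alpha>). \<beta> < \<alpha>} snd", goal_cases)
  case 1
  show ?case
    by (intro wf_inv_image wf)
next
  case (2 X \<alpha>)
  then obtain \<beta> where "is_pred \<beta> \<alpha>"
    by blast
  then show ?case
    using is_pred_the[of \<beta> \<alpha>] by (simp add: is_pred_def)
qed auto

declare E_stage.simps [simp del]

definition has_tcpe_rank :: "'a::discrete_topology config set \<Rightarrow> 'o::wellorder \<Rightarrow> bool" where
  "has_tcpe_rank X \<alpha> \<longleftrightarrow> ord_one \<le> \<alpha> \<and> E_stage X \<alpha> = X \<times> X \<and>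
    (\<forall>\<beta>. ord_one \<le> \<beta> \<and> \<beta> < \<alpha> \<longrightarrow> E_stage X \<beta> \<noteq> X \<times> X)"

lemma ord_one_nat: "(ord_one :: nat) = 1"
  unfolding ord_one_def by (rule Least_equality) auto

lemma E_stage_nat_1: "E_stage X (1::nat) = E1 X"
  by (simp add: E_stage.simps ord_one_nat)

lemma E_stage_nat_Suc:
  assumes "1 \<le> (n::nat)"
  shows "E_stage X (Suc n) = next_E X (E_stage X n)"
proof -
  have "is_pred n (Suc n)"
    by (auto simp: is_pred_def)
  with assms show ?thesis
    by (subst E_stage.simps) (auto simp: ord_one_nat is_pred_the)
qed

end

theory Submission
  imports Defs
begin

text \<open>
  Every column \<open>c\<close> of the subshift carries a bit \<open>V c\<close>. Diamond-shaped islands float in the plane,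
  and inside an island the bit of the column through its two apexes is flipped. The apexes of a
  diamond lie in the same column automatically, so \<open>V\<close> is the same above and below every island,
  although no local pattern inside an island reveals which column is flipped.

  A large window inside an island therefore looks the same for \<open>V\<close> and for \<open>V\<close> with one bit
  toggled, and islands can be inserted independently with positive density. So the all-grey points
  of \<open>V\<close> and of \<open>V\<close> with one bit toggled are joined by a chain of entropy pairs, and all points
  with finitely many islands, all of them finite, and finite \<open>V\<close> lie in one class of the
  equivalence relation generated by \<open>E1\<close>. These points are dense. Conversely, members of an
  entropy pair have functions \<open>V\<close> that differ in finitely many columns: if they differ in three
  columns, then no column of a point can show large windows of both members, which leaves at most
  \<open>2 ^ n\<close> cover elements on an \<open>n \<times> n\<close> window. Hence the generated equivalence relation is dense
  and proper. As \<open>E1\<close> is closed, the rank is 3.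
\<close>

section \<open>Entropy of covers\<close>

text \<open>The obstacle is to keep \<open>V\<close> rigid along columns and yet let it change
  without local evidence. An SFT that allows arbitrarily large islands also contains infinite ones,
  such as the plane filled with \<open>up\<close>, and these limit points do the work. Such a point
  is approximated by windows of diamonds centred at a chosen column and also by windows of diamonds
  centred far away, so it forms entropy pairs with two flat points whose \<open>V\<close> differ in
  that column.

  Three is the threshold in the converse because a window can leave open whether it contains the
  middle of one large run. It therefore fixes \<open>V\<close> on a finite set of columns up to one
  error, and a column showing windows of both members would allow at most two differences.

  The generated relation fails to be closed because windows see only finitely many columns, whereas
  infinitely many differences of \<open>V\<close> prevent two points from being related.\<close>

definition cover_on :: "'a config set \<Rightarrow> 'a config set set \<Rightarrow> (int \<times> int) set \<Rightarrow> 'a config set set" where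
  "cover_on X \<U> S = {X \<inter> (\<Inter>g\<in>S. shift g -` c g) | c. \<forall>g\<in>S. c g \<in> \<U>}"

lemma refined_cover_eq: "refined_cover X \<U> n = cover_on X \<U> (window n)"
  by (simp add: refined_cover_def cover_on_def)

lemma cover_onE:
  assumes "w \<in> cover_on X \<U> S"
  obtains c where "w = X \<inter> (\<Inter>g\<in>S. shift g -` c g)" "\<forall>g\<in>S. c g \<in> \<U>"
  using assms by (auto simp: cover_on_def)

lemma cover_onI: "(\<And>g. g \<in> S \<Longrightarrow> c g \<in> \<U>) \<Longrightarrow> X \<inter> (\<Inter>g\<in>S. shift g -` c g) \<in> cover_on X \<U> S"
  by (auto simp: cover_on_def)

lemma shift_shift: "shift g (shift h x) = shift (h + g) x"
  by (simp add: shift_def add.assoc)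

lemma shift_0: "shift 0 x = x"
  by (simp add: shift_def)

lemma finite_cover_on:
  assumes "finite S" "finite \<U>"
  shows "finite (cover_on X \<U> S)"
proof -
  have "cover_on X \<U> S \<subseteq> (\<lambda>c. X \<inter> (\<Inter>g\<in>S. shift g -` c g)) ` (S \<rightarrow>\<^sub>E \<U>)"
  proof
    fix w assume "w \<in> cover_on X \<U> S"
    then obtain c where c: "w = X \<inter> (\<Inter>g\<in>S. shift g -` c g)" "\<forall>g\<in>S. c g \<in> \<U>"
      by (auto simp: cover_on_def)
    then have "w = X \<inter> (\<Inter>g\<in>S. shift g -` restrict c S g)" "restrict c S \<in> S \<rightarrow>\<^sub>E \<U>"
      by auto
    then show "w \<in> (\<lambda>c. X \<inter> (\<Inter>g\<in>S. shift g -` c g)) ` (S \<rightarrow>\<^sub>E \<U>)"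
      by blast
  qed
  then show ?thesis
    using assms by (meson finite_PiE finite_imageI finite_subset)
qed

lemma min_subcover_le:
  assumes "\<W> \<subseteq> \<V>" "finite \<W>" "X \<subseteq> \<Union>\<W>"
  shows "min_subcover X \<V> \<le> card \<W>"
  unfolding min_subcover_def by (rule Least_le) (use assms in blast)

text \<open>Some finite subcover must exist for \<open>LEAST\<close> to be meaningful; here the
  finite cover itself is one.\<close>

lemma min_subcover_attained:
  assumes "finite \<V>" "X \<subseteq> \<Union>\<V>"
  obtains \<W> where "\<W> \<subseteq> \<V>" "finite \<W>" "X \<subseteq> \<Union>\<W>" "card \<W> = min_subcover X \<V>"
proof -
  have "\<exists>\<W>\<subseteq>\<V>. finite \<W> \<and> X \<subseteq> \<Union>\<W> \<and> card \<W> = min_subcover X \<V>"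
    unfolding min_subcover_def by (rule LeastI) (use assms in blast)
  then show ?thesis
    using that by blast
qed

section \<open>Submultiplicativity of covering numbers and convergence to the entropy\<close>

locale shift_cover =
  fixes X :: "'a config set" and \<U> :: "'a config set set"
  assumes inv: "\<And>g x. x \<in> X \<Longrightarrow> shift g x \<in> X"
    and covers: "X \<subseteq> \<Union>\<U>"
    and nonempty: "X \<noteq> {}"
    and finite_cover: "finite \<U>"
begin

text \<open>Arbitrary sets of positions are allowed because the tiling of a window leaves a
  remainder that is not a window.\<close>

definition size_on :: "(int \<times> int) set \<Rightarrow> nat" where
  "size_on S = min_subcover X (cover_on X \<U> S)"

lemma cover_on_covers: "X \<subseteq> \<Union>(cover_on X \<U> S)"
proof
  fix x assume x: "x \<in> X"
  then have "\<forall>g. \<exists>u. u \<in> \<U> \<and> shift g x \<in> u"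
    using inv covers by blast
  then obtain c where "\<And>g. c g \<in> \<U> \<and> shift g x \<in> c g"
    by metis
  then have "X \<inter> (\<Inter>g\<in>S. shift g -` c g) \<in> cover_on X \<U> S" "x \<in> X \<inter> (\<Inter>g\<in>S. shift g -` c g)"
    using x by (auto simp: cover_on_def)
  then show "x \<in> \<Union>(cover_on X \<U> S)"
    by blast
qed

lemma size_on_attained:
  assumes "finite S"
  obtains \<W> where "\<W> \<subseteq> cover_on X \<U> S" "finite \<W>" "X \<subseteq> \<Union>\<W>" "card \<W> = size_on S"
  using min_subcover_attained[OF finite_cover_on[OF assms finite_cover] cover_on_covers]
  unfolding size_on_def by metis

lemma size_on_pos:
  assumes "finite S"
  shows "size_on S \<ge> 1"
proof -
  obtain \<W> where "\<W> \<subseteq> cover_on X \<U> S" "finite \<W>" "X \<subseteq> \<Union>\<W>" "card \<W> = size_on S"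
    using size_on_attained[OF assms] .
  moreover from this nonempty have "\<W> \<noteq> {}"
    by auto
  ultimately show ?thesis
    by (metis Suc_leI card_gt_0_iff One_nat_def)
qed

text \<open>Each intersection of members of two optimal subcovers lies in a member of the joint
  refinement; at most one such member per pair is required.\<close>

lemma size_on_Un:
  assumes "finite S" "finite T"
  shows "size_on (S \<union> T) \<le> size_on S * size_on T"
proof -
  obtain \<V> where V: "\<V> \<subseteq> cover_on X \<U> S" "finite \<V>" "X \<subseteq> \<Union>\<V>" "card \<V> = size_on S"
    using size_on_attained[OF assms(1)] .
  obtain \<W> where W: "\<W> \<subseteq> cover_on X \<U> T" "finite \<W>" "X \<subseteq> \<Union>\<W>" "card \<W> = size_on T"
    using size_on_attained[OF assms(2)] .
  have ex: "\<exists>q \<in> cover_on X \<U> (S \<union> T). v \<inter> w \<subseteq> q" if vw: "v \<in> \<V>" "w \<in> \<W>" for v w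
  proof -
    obtain c where c: "v = X \<inter> (\<Inter>g\<in>S. shift g -` c g)" "\<forall>g\<in>S. c g \<in> \<U>"
      by (rule cover_onE[OF subsetD[OF V(1) vw(1)]])
    obtain d where d: "w = X \<inter> (\<Inter>g\<in>T. shift g -` d g)" "\<forall>g\<in>T. d g \<in> \<U>"
      by (rule cover_onE[OF subsetD[OF W(1) vw(2)]])
    \<comment> \<open>On \<open>S \<inter> T\<close> the choice of \<open>c\<close> wins and that of
      \<open>d\<close> is dropped, so \<open>v \<inter> w\<close> is only contained in the new
      member.\<close>
    let ?e = "\<lambda>g. if g \<in> S then c g else d g"
    have "X \<inter> (\<Inter>g\<in>S \<union> T. shift g -` ?e g) \<in> cover_on X \<U> (S \<union> T)"
      by (rule cover_onI) (use c(2) d(2) in auto)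
    moreover have "v \<inter> w \<subseteq> X \<inter> (\<Inter>g\<in>S \<union> T. shift g -` ?e g)"
      unfolding c(1) d(1) by auto
    ultimately show ?thesis by blast
  qed
  then obtain q where q: "\<And>v w. v \<in> \<V> \<Longrightarrow> w \<in> \<W> \<Longrightarrow> q v w \<in> cover_on X \<U> (S \<union> T) \<and> v \<inter> w \<subseteq> q v w"
    by metis
  let ?R = "(\<lambda>(v, w). q v w) ` (\<V> \<times> \<W>)"
  have "size_on (S \<union> T) \<le> card ?R"
    unfolding size_on_def
  proof (rule min_subcover_le)
    show "?R \<subseteq> cover_on X \<U> (S \<union> T)"
      using q by auto
    show "finite ?R"
      using V(2) W(2) by auto
    show "X \<subseteq> \<Union>?R"
    proof
      fix x assume "x \<in> X"
      then obtain v w where "v \<in> \<V>" "w \<in> \<W>" "x \<in> v" "x \<in> w"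
        using V(3) W(3) by blast
      then have "q v w \<in> ?R" "x \<in> q v w"
        using q[of v w] by auto
      then show "x \<in> \<Union>?R"
        by (rule UnionI)
    qed
  qed
  also have "\<dots> \<le> card (\<V> \<times> \<W>)"
    using V(2) W(2) by (intro card_image_le) auto
  finally show ?thesis
    using V(4) W(4) by (simp add: card_cartesian_product)
qed

text \<open>Pull an optimal subcover for \<open>S\<close> back along \<open>shift h\<close>;
  position \<open>g\<close> inherits the choice made at \<open>g - h\<close>.\<close>

lemma size_on_translate:
  assumes "finite S"
  shows "size_on ((+) h ` S) \<le> size_on S"
proof -
  obtain \<W> where W: "\<W> \<subseteq> cover_on X \<U> S" "finite \<W>" "X \<subseteq> \<Union>\<W>" "card \<W> = size_on S"
    using size_on_attained[OF assms] .
  let ?t = "\<lambda>w. X \<inter> shift h -` w"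
  have "size_on ((+) h ` S) \<le> card (?t ` \<W>)"
    unfolding size_on_def
  proof (rule min_subcover_le)
    show "finite (?t ` \<W>)"
      using W(2) by simp
    show "X \<subseteq> \<Union>(?t ` \<W>)"
    proof
      fix x assume x: "x \<in> X"
      then obtain w where "w \<in> \<W>" "shift h x \<in> w"
        using subsetD[OF W(3) inv[OF x]] by blast
      then show "x \<in> \<Union>(?t ` \<W>)"
        using x by blast
    qed
    show "?t ` \<W> \<subseteq> cover_on X \<U> ((+) h ` S)"
    proof
      fix v assume "v \<in> ?t ` \<W>"
      then obtain w where w: "v = X \<inter> shift h -` w" "w \<in> cover_on X \<U> S"
        using W(1) by blast
      obtain c where c: "w = X \<inter> (\<Inter>g\<in>S. shift g -` c g)" "\<forall>g\<in>S. c g \<in> \<U>"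
        by (rule cover_onE[OF w(2)])
      have "v = X \<inter> (\<Inter>g\<in>(+) h ` S. shift g -` c (g - h))"
        unfolding w(1) c(1) using inv[of _ h] by (auto simp: shift_shift)
      also have "\<dots> \<in> cover_on X \<U> ((+) h ` S)"
        by (rule cover_onI) (use c(2) in auto)
      finally show "v \<in> cover_on X \<U> ((+) h ` S)" .
    qed
  qed
  also have "\<dots> \<le> card \<W>"
    using W(2) by (rule card_image_le)
  finally show ?thesis
    using W(4) by simp
qed

lemma size_on_empty: "size_on {} = 1"
proof -
  have "cover_on X \<U> {} = {X}"
    by (auto simp: cover_on_def)
  then have "size_on {} \<le> card {X}"
    unfolding size_on_def by (intro min_subcover_le) auto
  then show ?thesis
    using size_on_pos[of "{}"] by simp
qed

lemma size_on_UN: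
  assumes "finite I" "\<And>i. i \<in> I \<Longrightarrow> finite (S i)" "\<And>i. i \<in> I \<Longrightarrow> size_on (S i) \<le> B"
  shows "size_on (\<Union>i\<in>I. S i) \<le> B ^ card I"
  using assms
proof (induction I rule: finite_induct)
  case empty
  then show ?case by (simp add: size_on_empty)
next
  case (insert i I)
  have "size_on (\<Union>i\<in>insert i I. S i) \<le> size_on (S i) * size_on (\<Union>i\<in>I. S i)"
    using size_on_Un[of "S i" "\<Union>i\<in>I. S i"] insert by auto
  also have "\<dots> \<le> B * B ^ card I"
    using insert by (intro mult_mono) auto
  finally show ?case
    using insert by simp
qed

text \<open>A crude bound, one factor 2 per cell; it pays for the cells that a tiling leaves
  over.\<close>

lemma size_on_le_power:
  assumes "finite S" "card \<U> \<le> 2"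
  shows "size_on S \<le> 2 ^ card S"
proof -
  have "size_on {g} \<le> 2" for g
  proof -
    let ?W = "(\<lambda>u. X \<inter> shift g -` u) ` \<U>"
    have "size_on {g} \<le> card ?W"
      unfolding size_on_def
    proof (rule min_subcover_le)
      show "?W \<subseteq> cover_on X \<U> {g}"
      proof
        fix w assume "w \<in> ?W"
        then obtain u where u: "u \<in> \<U>" "w = X \<inter> (\<Inter>g'\<in>{g}. shift g' -` u)"
          by auto
        show "w \<in> cover_on X \<U> {g}"
          unfolding u(2) by (rule cover_onI) (rule u(1))
      qed
      show "finite ?W"
        using finite_cover by simp
      show "X \<subseteq> \<Union>?W"
      proof
        fix x assume x: "x \<in> X"
        then obtain u where "u \<in> \<U>" "shift g x \<in> u"
          using subsetD[OF covers inv[OF x]] by blast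
        then show "x \<in> \<Union>?W"
          using x by blast
      qed
    qed
    also have "\<dots> \<le> card \<U>"
      using finite_cover by (rule card_image_le)
    finally show ?thesis
      using assms(2) by simp
  qed
  then show ?thesis
    using size_on_UN[of S "\<lambda>g. {g}" 2] assms(1) by simp
qed

lemma finite_window: "finite (window n)" and card_window: "card (window n) = n ^ 2"
  by (auto simp: window_def card_cartesian_product power2_eq_square)

text \<open>Tile the window by \<open>(n div k)\<^sup>2\<close> translates of the smaller one; the
  remainder is charged cell by cell.\<close>

lemma size_window_le:
  assumes "k \<ge> 1" "card \<U> \<le> 2"
  shows "size_on (window n) \<le> size_on (window k) ^ ((n div k)\<^sup>2) * 2 ^ (n\<^sup>2 - (k * (n div k))\<^sup>2)"
proof -
  define q where "q = n div k"
  let ?T = "\<lambda>a. (+) (int k * fst a, int k * snd a) ` window k"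
  have kq: "k * q \<le> n"
    by (simp add: q_def)
  have sub: "window (k * q) \<subseteq> window n"
  proof -
    have "int (k * q) \<le> int n"
      using kq by (simp only: of_nat_le_iff)
    then show ?thesis
      by (auto simp: window_def simp del: of_nat_mult)
  qed
  have "window (k * q) \<subseteq> (\<Union>a\<in>window q. ?T a)"
  proof clarify
    fix i j assume ij: "(i, j) \<in> window (k * q)"
    let ?a = "(i div int k, j div int k)" and ?r = "(i mod int k, j mod int k)"
    have "(i, j) = (int k * fst ?a, int k * snd ?a) + ?r"
      by simp
    moreover have "?r \<in> window k"
      using assms(1) by (auto simp: window_def)
    moreover have "?a \<in> window q"
    proof -
      have "0 \<le> c div int k \<and> c div int k < int q" if "0 \<le> c" "c < int (k * q)" for c
      proof
        show "0 \<le> c div int k"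
          using that(1) by (simp add: div_int_pos_iff)
        have "int k * (c div int k) \<le> c"
          using assms(1) by (simp add: minus_mod_eq_mult_div [symmetric])
        then have "int k * (c div int k) < int k * int q"
          using that(2) by simp
        then show "c div int k < int q"
          using assms(1) by (simp add: mult_less_cancel_left_pos)
      qed
      then show ?thesis
        using ij by (auto simp: window_def)
    qed
    ultimately have "(i, j) \<in> ?T ?a" "?a \<in> window q"
      by (auto intro: image_eqI[of _ _ ?r])
    then show "(i, j) \<in> (\<Union>a\<in>window q. ?T a)"
      by blast
  qed
  moreover have "(\<Union>a\<in>window q. ?T a) \<subseteq> window (k * q)"
  proof
    fix g assume "g \<in> (\<Union>a\<in>window q. ?T a)"
    then obtain a b i j where h: "(a, b) \<in> window q" "(i, j) \<in> window k"
      and g: "g = (int k * a + i, int k * b + j)"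
      by auto
    have le: "int k * c + d < int k * int q" if "c < int q" "d < int k" for c d
    proof -
      have "int k * c + d < int k * c + int k"
        using that by simp
      also have "\<dots> = int k * (c + 1)"
        by (simp add: algebra_simps)
      also have "\<dots> \<le> int k * int q"
        using that by (intro mult_left_mono) auto
      finally show ?thesis .
    qed
    show "g \<in> window (k * q)"
      using h le unfolding g by (auto simp: window_def)
  qed
  ultimately have eq: "window (k * q) = (\<Union>a\<in>window q. ?T a)"
    by blast
  have 1: "size_on (window (k * q)) \<le> size_on (window k) ^ card (window q)"
    unfolding eq
  proof (rule size_on_UN)
    show "size_on (?T a) \<le> size_on (window k)" for a
      by (rule size_on_translate[OF finite_window])
  qed (auto simp: finite_window)
  have 2: "size_on (window n - window (k * q)) \<le> 2 ^ card (window n - window (k * q))"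
    by (rule size_on_le_power) (auto simp: finite_window assms)
  have c: "card (window n - window (k * q)) = n\<^sup>2 - (k * q)\<^sup>2"
    using card_Diff_subset[OF finite_window sub] by (simp only: card_window)
  have "window n = window (k * q) \<union> (window n - window (k * q))"
    using sub by blast
  then have "size_on (window n) \<le> size_on (window (k * q)) * size_on (window n - window (k * q))"
    using size_on_Un[of "window (k * q)" "window n - window (k * q)"]
    by (simp only: finite_window finite_Diff)
  also have "\<dots> \<le> size_on (window k) ^ card (window q) * 2 ^ card (window n - window (k * q))"
    by (rule mult_le_mono[OF 1 2])
  finally show ?thesis
    unfolding c card_window unfolding q_def .
qed

text \<open>\<open>cover_entropy\<close> is a \<open>lim\<close>, whose value is unspecified for
  divergent sequences, so no lower bound for it can be derived before convergence is known.\<close>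

lemma convergent_entropy:
  assumes "card \<U> \<le> 2"
  shows "convergent (\<lambda>n. ln (real (size_on (window n))) / real n ^ 2)"
proof -
  define f where "f n = ln (real (size_on (window n)))" for n
  have pos: "real (size_on (window n)) \<ge> 1" for n
    using size_on_pos[OF finite_window, of n] by simp
  have f0: "f n \<ge> 0" for n
    using pos by (simp add: f_def)
  define L where "L = Inf ((\<lambda>k. f k / real k ^ 2) ` {1..})"
  have bdd: "bdd_below ((\<lambda>k. f k / real k ^ 2) ` {1..})"
    by (rule bdd_belowI[of _ 0]) (auto simp: f0)
  have Lle: "L \<le> f k / real k ^ 2" if "k \<ge> 1" for k
    unfolding L_def using that by (intro cInf_lower bdd) auto
  \<comment> \<open>The remainder has at most \<open>2 * k * n\<close> cells; divided by
    \<open>real n ^ 2\<close> this gives the error term.\<close>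
  have step: "f n / real n ^ 2 \<le> f k / real k ^ 2 + 2 * real k * ln 2 / real n"
    if k: "k \<ge> 1" and n: "n \<ge> k" for n k
  proof -
    define q where "q = n div k"
    define m where "m = k * q"
    have mn: "m \<le> n"
      by (simp add: m_def q_def)
    have "n = m + n mod k" "n mod k < k"
      using k by (simp_all add: m_def q_def)
    then have nm: "n - m \<le> k"
      by linarith
    have "f n \<le> ln (real (size_on (window k) ^ (q\<^sup>2) * 2 ^ (n\<^sup>2 - m\<^sup>2)))"
      unfolding f_def
    proof (rule ln_mono)
      show "real (size_on (window n)) \<le> real (size_on (window k) ^ q\<^sup>2 * 2 ^ (n\<^sup>2 - m\<^sup>2))"
        using size_window_le[OF k assms, of n] unfolding m_def q_def by (simp only: of_nat_le_iff)
    qed (use pos[of n] in auto)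
    also have "\<dots> = real (q\<^sup>2) * f k + real (n\<^sup>2 - m\<^sup>2) * ln 2"
      using pos[of k] by (simp add: f_def ln_mult ln_realpow)
    finally have 1: "f n \<le> real (q\<^sup>2) * f k + real (n\<^sup>2 - m\<^sup>2) * ln 2" .
    have "real (q\<^sup>2) * f k = real m ^ 2 * (f k / real k ^ 2)"
      using k by (simp add: m_def power_mult_distrib)
    also have "\<dots> \<le> real n ^ 2 * (f k / real k ^ 2)"
      using mn f0[of k] by (intro mult_right_mono power_mono) auto
    finally have 2: "real (q\<^sup>2) * f k \<le> real n ^ 2 * (f k / real k ^ 2)" .
    have "n\<^sup>2 - m\<^sup>2 = (n - m) * (n + m)"
      using mn by (simp add: power2_eq_square diff_mult_distrib diff_mult_distrib2 add_mult_distrib2 mult.commute)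
    also have "\<dots> \<le> k * (2 * n)"
      using mn nm by (intro mult_le_mono) auto
    finally have "real (n\<^sup>2 - m\<^sup>2) \<le> real (k * (2 * n))"
      by (simp only: of_nat_le_iff)
    then have 3: "real (n\<^sup>2 - m\<^sup>2) \<le> 2 * real k * real n"
      by (simp add: mult_ac)
    have "f n \<le> real n ^ 2 * (f k / real k ^ 2) + 2 * real k * real n * ln 2"
      using 1 2 mult_right_mono[OF 3 ln_ge_zero[of 2]] by linarith
    then have "f n / real n ^ 2 \<le> (real n ^ 2 * (f k / real k ^ 2) + 2 * real k * real n * ln 2) / real n ^ 2"
      by (intro divide_right_mono) auto
    also have "\<dots> = f k / real k ^ 2 + 2 * real k * ln 2 / real n"
      using k n by (simp add: add_divide_distrib power2_eq_square)
    finally show ?thesis .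
  qed
  \<comment> \<open>Fekete's lemma, where \<open>step\<close> replaces subadditivity.\<close>
  have "(\<lambda>n. f n / real n ^ 2) \<longlonglongrightarrow> L"
  proof (rule LIMSEQ_I)
    fix e :: real assume e: "e > 0"
    have "\<exists>k\<ge>1. f k / real k ^ 2 < L + e / 2"
    proof (rule ccontr)
      assume "\<not> ?thesis"
      then have "L + e / 2 \<le> L"
        unfolding L_def by (intro cInf_greatest[where z = "Inf _ + e / 2"]) (auto simp: not_less)
      with e show False by simp
    qed
    then obtain k where k: "k \<ge> 1" "f k / real k ^ 2 < L + e / 2"
      by blast
    obtain M :: nat where M: "real M > 4 * real k * ln 2 / e"
      using reals_Archimedean2 by blast
    show "\<exists>no. \<forall>n\<ge>no. norm (f n / real n ^ 2 - L) < e"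
    proof (intro exI allI impI)
      fix n assume n: "n \<ge> max k M"
      then have n1: "n \<ge> 1" and nk: "n \<ge> k" and nM: "real n \<ge> real M"
        using k by auto
      have "4 * real k * ln 2 / e < real n"
        using M nM by simp
      then have "2 * real k * ln 2 / real n < e / 2"
        using e n1 by (simp add: field_simps)
      then show "norm (f n / real n ^ 2 - L) < e"
        using step[OF k(1) nk] k(2) Lle[OF n1] by auto
    qed
  qed
  then show ?thesis
    unfolding f_def convergent_def by blast
qed

end

text \<open>At each position a member of the refinement avoids \<open>K\<close> or avoids
  \<open>L\<close>, so it cannot contain two points whose patterns \<open>\<phi>\<close> differ at a
  lattice position of the window. All patterns on \<open>q \<times> q\<close> lattice positions are
  realised, hence every subcover has at least \<open>2 ^ (q\<^sup>2)\<close> members.\<close>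

lemma entropy_pos_if_independent:
  fixes X :: "'a config set"
  assumes inv: "\<And>g x. x \<in> X \<Longrightarrow> shift g x \<in> X" and disj: "K \<inter> L = {}" and N: "N \<ge> (1::nat)"
    and indep: "\<And>\<phi>. \<exists>z\<in>X. \<forall>a b. shift (int N * a, int N * b) z \<in> (if \<phi> (a, b) then K else L)"
  shows "cover_entropy X {X - K, X - L} > 0"
proof -
  have ne: "X \<noteq> {}"
    using indep by blast
  interpret shift_cover X "{X - K, X - L}"
    using inv disj ne by unfold_locales auto
  have c2: "card {X - K, X - L} \<le> 2"
    by (simp add: card_insert_if)
  let ?s = "\<lambda>n. ln (real (size_on (window n))) / real n ^ 2"
  have "convergent ?s"
    by (rule convergent_entropy[OF c2])
  moreover have "cover_entropy X {X - K, X - L} = lim ?s"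
    by (simp add: cover_entropy_def size_on_def refined_cover_eq)
  ultimately have lim: "?s \<longlonglongrightarrow> cover_entropy X {X - K, X - L}"
    by (simp add: convergent_LIMSEQ_iff)
  have lower: "2 ^ (q\<^sup>2) \<le> size_on (window n)" if q: "q = n div N" for n q
  proof -
    obtain \<W> where W: "\<W> \<subseteq> cover_on X {X - K, X - L} (window n)" "finite \<W>" "X \<subseteq> \<Union>\<W>"
      "card \<W> = size_on (window n)"
      using size_on_attained[OF finite_window] .
    have "\<forall>T. \<exists>z\<in>X. \<forall>a b. shift (int N * a, int N * b) z \<in> (if (a, b) \<in> T then K else L)"
    proof
      fix T
      show "\<exists>z\<in>X. \<forall>a b. shift (int N * a, int N * b) z \<in> (if (a, b) \<in> T then K else L)"
        using indep[of "\<lambda>p. p \<in> T"] .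
    qed
    then obtain z where z: "\<And>T. z T \<in> X"
      "\<And>T a b. shift (int N * a, int N * b) (z T) \<in> (if (a, b) \<in> T then K else L)"
      by metis
    have "\<forall>T. \<exists>w\<in>\<W>. z T \<in> w"
      using z(1) W(3) by blast
    then obtain w where w: "\<And>T. w T \<in> \<W>" "\<And>T. z T \<in> w T"
      by metis
    have eq: "a \<in> T'" if T: "a \<in> T" "w T = w T'" "a \<in> window q" for a T T'
    proof (rule ccontr)
      assume a: "a \<notin> T'"
      obtain i j where ij: "a = (i, j)"
        by (cases a)
      have "int N * i < int n" if "i < int q" for i
      proof -
        have "int N * i < int N * int q"
          using that N by simp
        also have "\<dots> \<le> int n"
          unfolding q by (metis of_nat_le_iff of_nat_mult times_div_less_eq_dividend)
        finally show ?thesis .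
      qed
      then have g: "(int N * i, int N * j) \<in> window n"
        using T(3) unfolding ij window_def by auto
      obtain c where c: "w T = X \<inter> (\<Inter>g\<in>window n. shift g -` c g)"
        "\<forall>g\<in>window n. c g \<in> {X - K, X - L}"
        by (rule cover_onE[OF subsetD[OF W(1) w(1)[of T]]])
      have "shift (int N * i, int N * j) (z T) \<in> c (int N * i, int N * j)"
        "shift (int N * i, int N * j) (z T') \<in> c (int N * i, int N * j)"
        using w(2)[of T] w(2)[of T'] T(2) c(1) g by auto
      moreover have "shift (int N * i, int N * j) (z T) \<in> K" "shift (int N * i, int N * j) (z T') \<in> L"
        using z(2)[of i j T] z(2)[of i j T'] T(1) a ij by auto
      ultimately show False
        using c(2) g by auto
    qed
    have "inj_on w (Pow (window q))"
    proof (rule inj_onI)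
      fix T T' assume "T \<in> Pow (window q)" "T' \<in> Pow (window q)" "w T = w T'"
      then show "T = T'"
        using eq[of _ T T'] eq[of _ T' T] by auto
    qed
    then have "card (Pow (window q)) \<le> card \<W>"
      using w(1) W(2) by (intro card_inj_on_le[of w]) auto
    then show ?thesis
      using W(4) by (simp add: card_Pow finite_window card_window)
  qed
  \<comment> \<open>For \<open>n \<ge> N\<close> the quotient \<open>q = n div N\<close> is at least
    1, so \<open>n \<le> 2 * N * q\<close>; squaring yields the factor 4.\<close>
  let ?d = "ln 2 / (4 * real N ^ 2)"
  have "?s n \<ge> ?d" if n: "n \<ge> N" for n
  proof -
    define q where "q = n div N"
    have q1: "q \<ge> 1"
      using n N by (simp add: q_def Suc_leI div_greater_zero_iff)
    have "n < N * q + N"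
      using N by (metis add.commute dividend_less_times_div less_eq_Suc_le One_nat_def q_def)
    also have "\<dots> \<le> N * q + N * q"
      using q1 by simp
    finally have "real n \<le> 2 * real N * real q"
      by (metis (mono_tags, lifting) less_imp_le mult.assoc mult_2 of_nat_add of_nat_le_iff of_nat_mult)
    then have "real n ^ 2 \<le> (2 * real N * real q) ^ 2"
      by (intro power_mono) auto
    then have sq: "real n ^ 2 \<le> 4 * real N ^ 2 * real q ^ 2"
      by (simp add: power_mult_distrib)
    have "real q ^ 2 * ln 2 = ln (real (2 ^ (q\<^sup>2)))"
      by (simp add: ln_realpow)
    also have "\<dots> \<le> ln (real (size_on (window n)))"
    proof (rule ln_mono)
      show "real (2 ^ q\<^sup>2) \<le> real (size_on (window n))"
        using lower[OF q_def] by (simp only: of_nat_le_iff)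
    qed auto
    finally have 1: "real q ^ 2 * ln 2 \<le> ln (real (size_on (window n)))" .
    have "?d * real n ^ 2 \<le> ?d * (4 * real N ^ 2 * real q ^ 2)"
      by (rule mult_left_mono[OF sq]) auto
    also have "\<dots> = real q ^ 2 * ln 2"
      using N by simp
    finally have "?d * real n ^ 2 \<le> ln (real (size_on (window n)))"
      using 1 by simp
    moreover have "real n ^ 2 > 0"
      using n N by simp
    ultimately show ?thesis
      by (simp only: pos_le_divide_eq)
  qed
  then have "?d \<le> cover_entropy X {X - K, X - L}"
    using lim by (intro LIMSEQ_le_const[OF lim]) blast
  moreover have "?d > 0"
    using N by simp
  ultimately show ?thesis
    by linarith
qed

text \<open>In each column of a point at most one of \<open>K\<close> and \<open>L\<close> is ever
  visible, so one bit per column tells which complement to choose at all heights: \<open>n\<close>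
  bits for \<open>n\<^sup>2\<close> positions.\<close>

lemma entropy_zero_if_column_exclusive:
  fixes X :: "'a config set"
  assumes inv: "\<And>g x. x \<in> X \<Longrightarrow> shift g x \<in> X" and ne: "X \<noteq> {}"
    and excl: "\<And>x i j j'. x \<in> X \<Longrightarrow> shift (i, j) x \<in> K \<Longrightarrow> shift (i, j') x \<in> L \<Longrightarrow> False"
  shows "cover_entropy X {X - K, X - L} = 0"
proof -
  have disj: "X \<inter> K \<inter> L = {}"
    using excl[of _ 0 0 0] unfolding zero_prod_def[symmetric] shift_0 by auto
  interpret shift_cover X "{X - K, X - L}"
  proof
    show "X \<subseteq> \<Union>{X - K, X - L}"
      using disj by blast
  qed (use inv ne in simp_all)
  let ?s = "\<lambda>n. ln (real (size_on (window n))) / real n ^ 2"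
  have upper: "size_on (window n) \<le> 2 ^ n" for n
  proof -
    let ?w = "\<lambda>T. X \<inter> (\<Inter>g\<in>window n. shift g -` (if fst g \<in> T then X - L else X - K))"
    let ?W = "?w ` Pow {0..<int n}"
    have "size_on (window n) \<le> card ?W"
      unfolding size_on_def
    proof (rule min_subcover_le)
      show "?W \<subseteq> cover_on X {X - K, X - L} (window n)"
      proof
        fix w assume "w \<in> ?W"
        then obtain T where w: "w = ?w T" by blast
        show "w \<in> cover_on X {X - K, X - L} (window n)"
          unfolding w by (rule cover_onI) auto
      qed
      show "finite ?W" by simp
      show "X \<subseteq> \<Union>?W"
      proof
        fix x assume x: "x \<in> X"
        \<comment> \<open>The height \<open>j\<close> is not confined to the window:
          \<open>excl\<close> compares arbitrary heights of a column.\<close>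
        let ?T = "{i \<in> {0..<int n}. \<exists>j. shift (i, j) x \<in> K}"
        have "x \<in> ?w ?T"
        proof (rule IntI[OF x], rule INT_I)
          fix g assume g: "g \<in> window n"
          show "x \<in> shift g -` (if fst g \<in> ?T then X - L else X - K)"
          proof (cases "fst g \<in> ?T")
            case True
            then obtain j where "shift (fst g, j) x \<in> K"
              by blast
            then have "shift g x \<notin> L"
              using excl[OF x, of "fst g" j "snd g"] by auto
            then show ?thesis
              using True inv[OF x, of g] by simp
          next
            case False
            then have "shift g x \<notin> K"
              using g by (cases g) (auto simp: window_def)
            then show ?thesis
              unfolding if_not_P[OF False] using inv[OF x, of g] by simp
          qed
        qed
        moreover have "?w ?T \<in> ?W"
          by (rule imageI) auto
        ultimately show "x \<in> \<Union>?W"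
          by (rule UnionI[rotated])
      qed
    qed
    also have "\<dots> \<le> card (Pow {0..<int n})"
      by (rule card_image_le) simp
    finally show ?thesis
      by (simp add: card_Pow)
  qed
  have "?s \<longlonglongrightarrow> 0"
  proof (rule tendsto_sandwich)
    show "\<forall>\<^sub>F n in sequentially. 0 \<le> ?s n"
      using size_on_pos[OF finite_window] by (intro always_eventually allI divide_nonneg_nonneg) auto
    show "\<forall>\<^sub>F n in sequentially. ?s n \<le> ln 2 * inverse (real n)"
    proof (intro always_eventually allI)
      fix n
      have "ln (real (size_on (window n))) \<le> ln (real (2 ^ n))"
      proof (rule ln_mono)
        show "real (size_on (window n)) \<le> real (2 ^ n)"
          using upper by (simp only: of_nat_le_iff)
      qed (use size_on_pos[OF finite_window, of n] in auto)
      also have "\<dots> = real n * ln 2"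
        by (simp add: ln_realpow)
      finally have "?s n \<le> real n * ln 2 / real n ^ 2"
        by (rule divide_right_mono) auto
      also have "\<dots> = ln 2 * inverse (real n)"
          by (cases "n = 0") (simp_all add: power2_eq_square divide_inverse)
      finally show "?s n \<le> ln 2 * inverse (real n)" .
    qed
    show "(\<lambda>n. ln 2 * inverse (real n)) \<longlonglongrightarrow> 0"
      by (rule tendsto_mult_right_zero[OF lim_inverse_n])
  qed auto
  then show ?thesis
    by (simp add: cover_entropy_def limI refined_cover_eq flip: size_on_def)
qed

section \<open>Subshifts in the product topology\<close>

text \<open>Cylinders over square boxes form a neighbourhood basis of the product topology
  (\<open>open_iff_agree\<close>), so topology can be handled through finite windows.\<close>

definition agree :: "nat \<Rightarrow> 'a config \<Rightarrow> 'a config \<Rightarrow> bool" where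
  "agree m x y \<longleftrightarrow> (\<forall>i j. \<bar>i\<bar> \<le> int m \<and> \<bar>j\<bar> \<le> int m \<longrightarrow> x (i, j) = y (i, j))"

lemma agree_refl: "agree m x x"
  by (simp add: agree_def)

lemma agree_sym: "agree m x y \<longleftrightarrow> agree m y x"
  by (auto simp: agree_def)

lemma agree_mono: "agree m x y \<Longrightarrow> m' \<le> m \<Longrightarrow> agree m' x y"
  by (force simp: agree_def)

lemma agree_trans: "agree m x y \<Longrightarrow> agree m y z \<Longrightarrow> agree m x z"
  by (auto simp: agree_def)

lemma agree_maxD:
  assumes "agree (max m l) x y"
  shows "agree m x y" "agree l x y"
  using assms agree_mono by (metis max.cobounded1, metis max.cobounded2)

lemma agreeD: "agree m x y \<Longrightarrow> \<bar>i\<bar> \<le> int m \<Longrightarrow> \<bar>j\<bar> \<le> int m \<Longrightarrow> x (i, j) = y (i, j)"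
  by (simp add: agree_def)

lemma open_agree: "open {y :: 'a::discrete_topology config. agree m x y}"
proof -
  let ?I = "{- int m..int m} \<times> {- int m..int m}"
  have "{y. agree m x y} = {y. \<forall>p\<in>?I. y (id p) \<in> {x p}}"
    by (auto simp: agree_def abs_le_iff)
  also have "open \<dots>"
    by (rule product_topology_basis') (auto simp: open_discrete)
  finally show ?thesis .
qed

lemma open_contains_agree:
  fixes U :: "'a::discrete_topology config set"
  assumes "open U" "x \<in> U"
  obtains m where "\<And>y. agree m x y \<Longrightarrow> y \<in> U"
proof -
  have "openin (product_topology (\<lambda>i. euclidean) UNIV) U"
    using assms(1) by (simp add: open_fun_def)
  from product_topology_open_contains_basis[OF this assms(2)]
  obtain F where F: "x \<in> (\<Pi>\<^sub>E i\<in>UNIV. F i)" "finite {i. F i \<noteq> UNIV}" "(\<Pi>\<^sub>E i\<in>UNIV. F i) \<subseteq> U"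
    by auto
  obtain B where B: "\<And>p. p \<in> {i. F i \<noteq> UNIV} \<Longrightarrow> max \<bar>fst p\<bar> \<bar>snd p\<bar> \<le> B"
    using bdd_above_finite[OF finite_imageI[OF F(2), of "\<lambda>p. max \<bar>fst p\<bar> \<bar>snd p\<bar>"]]
    unfolding bdd_above_def by blast
  have "y \<in> U" if y: "agree (nat B) x y" for y
  proof -
    have "y p \<in> F p" for p
    proof (cases "F p = UNIV")
      case False
      obtain i j where p: "p = (i, j)"
        by (cases p)
      then have "\<bar>i\<bar> \<le> B" "\<bar>j\<bar> \<le> B"
        using B[of p] False by auto
      then have "\<bar>i\<bar> \<le> int (nat B)" "\<bar>j\<bar> \<le> int (nat B)"
        by linarith+
      then have "y p = x p"
        using agreeD[OF y, of i j] p by (simp del: int_nat_eq)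
      then show ?thesis
        using F(1) by auto
    qed simp
    then show ?thesis
      using F(3) by auto
  qed
  then show ?thesis
    using that by blast
qed

lemma open_iff_agree:
  fixes U :: "'a::discrete_topology config set"
  shows "open U \<longleftrightarrow> (\<forall>x\<in>U. \<exists>m. \<forall>y. agree m x y \<longrightarrow> y \<in> U)"
proof
  assume "open U"
  then show "\<forall>x\<in>U. \<exists>m. \<forall>y. agree m x y \<longrightarrow> y \<in> U"
    using open_contains_agree by metis
next
  assume h: "\<forall>x\<in>U. \<exists>m. \<forall>y. agree m x y \<longrightarrow> y \<in> U"
  show "open U"
  proof (subst open_subopen, rule ballI)
    fix x assume "x \<in> U"
    then obtain m where "\<forall>y. agree m x y \<longrightarrow> y \<in> U"
      using h by blast
    then show "\<exists>T. open T \<and> x \<in> T \<and> T \<subseteq> U"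
      using open_agree[of m x] by (intro exI[of _ "{y. agree m x y}"]) (auto simp: agree_refl)
  qed
qed

lemma closed_agree: "closed {y :: 'a::discrete_topology config. agree m x y}"
  unfolding closed_def open_iff_agree
proof (intro ballI exI allI impI)
  fix y z assume "y \<in> - {y. agree m x y}" "agree m y z"
  then show "z \<in> - {y. agree m x y}"
    by (auto simp: agree_sym[of m y z] dest: agree_trans)
qed

lemma closed_nbhd_agree:
  fixes x :: "'a::discrete_topology config"
  assumes "x \<in> X"
  shows "closed_nbhd X x {y \<in> X. agree m x y}"
  unfolding closed_nbhd_def
proof (intro conjI exI)
  have eq: "{y \<in> X. agree m x y} = X \<inter> {y. agree m x y}"
    by blast
  show "closedin (top_of_set X) {y \<in> X. agree m x y}"
    unfolding eq by (rule closedin_closed_Int[OF closed_agree])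
  show "openin (top_of_set X) {y \<in> X. agree m x y}"
    unfolding eq by (rule openin_open_Int[OF open_agree])
qed (use assms in \<open>auto simp: agree_refl\<close>)

lemma closed_nbhdE:
  fixes x :: "'a::discrete_topology config"
  assumes "closed_nbhd X x K"
  obtains m where "\<And>y. y \<in> X \<Longrightarrow> agree m x y \<Longrightarrow> y \<in> K"
proof -
  obtain U where "openin (top_of_set X) U" "x \<in> U" "U \<subseteq> K"
    using assms by (auto simp: closed_nbhd_def)
  then obtain T where T: "open T" "U = X \<inter> T"
    by (auto simp: openin_open)
  then obtain m where "\<And>y. agree m x y \<Longrightarrow> y \<in> T"
    using open_contains_agree[OF T(1)] \<open>x \<in> U\<close> by blast
  then show ?thesis
    using that T(2) \<open>U \<subseteq> K\<close> by blast
qed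

section \<open>Closedness of \<open>E1\<close> and the rank criterion\<close>

lemma eventually_closed_nbhd:
  fixes x :: "'a::discrete_topology config"
  assumes "closed_nbhd X x K"
  obtains m where "\<And>y. y \<in> X \<Longrightarrow> agree m x y \<Longrightarrow> closed_nbhd X y K"
proof -
  obtain U where U: "openin (top_of_set X) U" "x \<in> U" "U \<subseteq> K"
    using assms by (auto simp: closed_nbhd_def)
  then obtain T where T: "open T" "U = X \<inter> T"
    by (auto simp: openin_open)
  obtain m where m: "\<And>y. agree m x y \<Longrightarrow> y \<in> T"
    using open_contains_agree[OF T(1)] U(2) T(2) by blast
  have "closed_nbhd X y K" if "y \<in> X" "agree m x y" for y
    unfolding closed_nbhd_def
    using assms U T(2) m[OF that(2)] that(1) by (auto simp: closed_nbhd_def)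
  then show ?thesis
    using that by blast
qed

text \<open>If disjoint \<open>K\<close> and \<open>L\<close> witness that a pair is no entropy
  pair, they are also neighbourhoods of the members of all nearby pairs and witness the same there.
  Disjointness keeps nearby pairs off the diagonal.\<close>

lemma closed_E1:
  fixes X :: "'a::discrete_topology config set"
  assumes "closed X"
  shows "closed (E1 X)"
  unfolding closed_def
proof (subst open_subopen, rule ballI)
  fix p assume p: "p \<in> - E1 X"
  obtain x y where xy: "p = (x, y)"
    by (cases p)
  have "\<exists>m. \<forall>x' y'. agree m x x' \<and> agree m y y' \<longrightarrow> (x', y') \<notin> E1 X"
  proof (cases "x \<in> X \<and> y \<in> X")
    case False
    have "open (- X)"
      using assms by (simp add: closed_def)
    then have "\<exists>m. (\<forall>x'. agree m x x' \<longrightarrow> x' \<notin> X) \<or> (\<forall>y'. agree m y y' \<longrightarrow> y' \<notin> X)"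
      using False unfolding open_iff_agree by (meson ComplD ComplI)
    then show ?thesis
      unfolding E1_def by blast
  next
    case True
    then have "x \<noteq> y" "\<not> entropy_pair X x y"
      using p xy by (auto simp: E1_def)
    then obtain K L where KL: "closed_nbhd X x K" "closed_nbhd X y L" "K \<inter> L = {}"
      "\<not> cover_entropy X {X - K, X - L} > 0"
      using True unfolding entropy_pair_def by blast
    obtain m where m: "\<And>z. z \<in> X \<Longrightarrow> agree m x z \<Longrightarrow> closed_nbhd X z K"
      using eventually_closed_nbhd[OF KL(1)] by blast
    obtain l where l: "\<And>z. z \<in> X \<Longrightarrow> agree l y z \<Longrightarrow> closed_nbhd X z L"
      using eventually_closed_nbhd[OF KL(2)] by blast
    have "(x', y') \<notin> E1 X" if a: "agree (max m l) x x'" "agree (max m l) y y'" for x' y'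
    proof
      assume e: "(x', y') \<in> E1 X"
      then have X: "x' \<in> X" "y' \<in> X"
        by (auto simp: E1_def)
      have n: "closed_nbhd X x' K" "closed_nbhd X y' L"
        using m[OF X(1)] l[OF X(2)] agree_maxD a by blast+
      then have "x' \<in> K" "y' \<in> L"
        by (auto simp: closed_nbhd_def)
      then have "entropy_pair X x' y'"
        using e KL(3) by (auto simp: E1_def)
      then show False
        using n KL(3,4) unfolding entropy_pair_def by blast
    qed
    then show ?thesis by blast
  qed
  then obtain m where m: "\<And>x' y'. agree m x x' \<Longrightarrow> agree m y y' \<Longrightarrow> (x', y') \<notin> E1 X"
    by blast
  have "{x'. agree m x x'} \<times> {y'. agree m y y'} \<subseteq> - E1 X"
    using m by auto
  moreover have "open ({x'. agree m x x'} \<times> {y'. agree m y y'})"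
    by (intro open_Times open_agree)
  ultimately show "\<exists>T. open T \<and> p \<in> T \<and> T \<subseteq> - E1 X"
    unfolding xy by (blast intro: agree_refl)
qed

lemma closure_eq_if_agree_dense:
  fixes X :: "'a::discrete_topology config set"
  assumes "closed X" "R \<subseteq> X \<times> X"
    and dense: "\<And>x y m. x \<in> X \<Longrightarrow> y \<in> X \<Longrightarrow> \<exists>(x', y')\<in>R. agree m x x' \<and> agree m y y'"
  shows "closure R = X \<times> X"
proof
  show "closure R \<subseteq> X \<times> X"
    using assms(1,2) by (intro closure_minimal closed_Times)
  show "X \<times> X \<subseteq> closure R"
  proof clarify
    fix x y assume xy: "x \<in> X" "y \<in> X"
    show "(x, y) \<in> closure R"
      unfolding closure_iff_nhds_not_empty
    proof (intro allI impI)
      fix A U assume U: "U \<subseteq> A" "open U" "(x, y) \<in> U"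
      then obtain S T where ST: "open S" "open T" "x \<in> S" "y \<in> T" "S \<times> T \<subseteq> U"
        by (auto elim: open_prod_elim)
      obtain m where m: "\<And>z. agree m x z \<Longrightarrow> z \<in> S"
        using open_contains_agree[OF ST(1,3)] by blast
      obtain l where l: "\<And>z. agree l y z \<Longrightarrow> z \<in> T"
        using open_contains_agree[OF ST(2,4)] by blast
      obtain x' y' where "(x', y') \<in> R" "agree (max m l) x x'" "agree (max m l) y y'"
        using dense[OF xy, of "max m l"] by blast
      then have "(x', y') \<in> R" "x' \<in> S" "y' \<in> T"
        using m l agree_maxD by blast+
      then show "R \<inter> A \<noteq> {}"
        using ST(5) U(1) by blast
    qed
  qed
qed

text \<open>Stage 1 is closed, so stage 2 is the generated equivalence relation. Being dense and
  proper, it is not closed, so stage 3 is its closure, which is everything.\<close>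

lemma rank_three_if_dense_proper:
  fixes X :: "'a::discrete_topology config set"
  assumes "closed X"
    and dense: "\<And>x y m. x \<in> X \<Longrightarrow> y \<in> X \<Longrightarrow>
      \<exists>(x', y')\<in>(E1 X \<union> (E1 X)\<inverse>)\<^sup>+. agree m x x' \<and> agree m y y'"
    and proper: "(E1 X \<union> (E1 X)\<inverse>)\<^sup>+ \<noteq> X \<times> X"
  shows "has_tcpe_rank X (3::nat)"
proof -
  let ?R = "(E1 X \<union> (E1 X)\<inverse>)\<^sup>+"
  have sub: "E1 X \<subseteq> X \<times> X"
    by (auto simp: E1_def)
  have R: "?R \<subseteq> X \<times> X"
    using trancl_subset_Sigma[of "E1 X \<union> (E1 X)\<inverse>" X] sub by blast
  have cl: "closure ?R = X \<times> X"
    by (rule closure_eq_if_agree_dense[OF assms(1) R dense])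
  have E2: "E_stage X (2::nat) = ?R"
  proof -
    have "E_stage X (2::nat) = next_E X (E1 X)"
      using E_stage_nat_Suc[of 1 X] E_stage_nat_1[of X] by (simp add: numeral_2_eq_2)
    also have "\<dots> = ?R"
    proof (cases "equiv X (E1 X)")
      \<comment> \<open>\<open>next_E\<close> leaves an equivalence relation alone, but then the
        transitive symmetric closure changes nothing either.\<close>
      case True
      then have "E1 X \<union> (E1 X)\<inverse> = E1 X"
        by (auto simp: equiv_def sym_def)
      moreover have "(E1 X)\<^sup>+ = E1 X"
        using True by (simp add: equiv_def trancl_id)
      ultimately show ?thesis
        using True closed_E1[OF assms(1)] by (simp add: next_E_def)
    next
      case False
      then show ?thesis
        using closed_E1[OF assms(1)] by (simp add: next_E_def)
    qed
    finally show ?thesis .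
  qed
  have "\<not> closed ?R"
    using cl proper by (metis closure_closed)
  then have E3: "E_stage X (3::nat) = X \<times> X"
    using E_stage_nat_Suc[of 2 X] E2 cl by (simp add: numeral_3_eq_3 numeral_2_eq_2 next_E_def)
  have "E1 X \<noteq> X \<times> X"
  proof
    assume e: "E1 X = X \<times> X"
    have "E1 X \<subseteq> ?R"
      by (auto intro: r_into_trancl)
    then show False
      using e R proper by blast
  qed
  then have "E_stage X \<beta> \<noteq> X \<times> X" if "1 \<le> \<beta>" "\<beta> < 3" for \<beta> :: nat
  proof -
    have "\<beta> = 1 \<or> \<beta> = 2"
      using that by linarith
    then show ?thesis
      using \<open>E1 X \<noteq> X \<times> X\<close> proper E2 E_stage_nat_1[of X] by auto
  qed
  then show ?thesis
    using E3 by (simp add: has_tcpe_rank_def ord_one_nat)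
qed

text \<open>Forbid every pattern on the box of radius \<open>r\<close> that violates
  \<open>ok\<close>; there are finitely many because \<open>A\<close> is finite.\<close>

lemma sft_if_local_rule:
  fixes A :: "'a::discrete_topology set" and ok :: "'a config \<Rightarrow> bool"
  assumes fin: "finite A"
    and loc: "\<And>x y. agree r x y \<Longrightarrow> ok x \<Longrightarrow> ok y"
  shows "sft A {x \<in> UNIV \<rightarrow> A. \<forall>g. ok (shift g x)}" (is "sft A ?X")
proof -
  have sub: "subshift A ?X"
    unfolding subshift_def
  proof (intro conjI allI)
    show "closed ?X"
      unfolding closed_def open_iff_agree
    proof
      fix x assume "x \<in> - ?X"
      then consider (val) i j where "x (i, j) \<notin> A" | (rule) i j where "\<not> ok (shift (i, j) x)"
        by (auto simp: Pi_iff)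
      then show "\<exists>m. \<forall>y. agree m x y \<longrightarrow> y \<in> - ?X"
      proof cases
        case val
        have "y (i, j) \<notin> A" if "agree (nat (\<bar>i\<bar> + \<bar>j\<bar>)) x y" for y
          using agreeD[OF that, of i j] val by simp
        then show ?thesis by blast
      next
        case rule
        have "\<not> ok (shift (i, j) y)" if y: "agree (nat (\<bar>i\<bar> + \<bar>j\<bar>) + r) x y" for y
        proof -
          have "agree r (shift (i, j) y) (shift (i, j) x)"
            unfolding agree_def shift_def
          proof (intro allI impI)
            fix a b assume "\<bar>a\<bar> \<le> int r \<and> \<bar>b\<bar> \<le> int r"
            then have "\<bar>i + a\<bar> \<le> int (nat (\<bar>i\<bar> + \<bar>j\<bar>) + r)" "\<bar>j + b\<bar> \<le> int (nat (\<bar>i\<bar> + \<bar>j\<bar>) + r)"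
              by linarith+
            then show "y ((i, j) + (a, b)) = x ((i, j) + (a, b))"
              using y by (simp add: agree_def)
          qed
          then show ?thesis
            using loc rule by blast
        qed
        then show ?thesis by blast
      qed
    qed
    fix g
    show "shift g ` ?X \<subseteq> ?X"
    proof clarify
      fix x assume x: "x \<in> UNIV \<rightarrow> A" "\<forall>g. ok (shift g x)"
      have "shift h (shift g x) = shift (g + h) x" for h
        by (simp add: shift_def add.assoc)
      then have "ok (shift h (shift g x))" for h
        using x(2) by metis
      moreover have "shift g x \<in> UNIV \<rightarrow> A"
        using x(1) unfolding shift_def Pi_iff by blast
      ultimately show "shift g x \<in> UNIV \<rightarrow> A \<and> (\<forall>h. ok (shift h (shift g x)))"
        by blast
    qed
  qed (use fin in auto)
  let ?B = "{- int r..int r} \<times> {- int r..int r}"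
  \<comment> \<open>Outside the box \<open>the (p h)\<close> is \<open>the None\<close>, an
    arbitrary value; by \<open>loc\<close> it cannot influence \<open>ok\<close>.\<close>
  let ?F = "{p. dom p = ?B \<and> ran p \<subseteq> A \<and> \<not> ok (\<lambda>h. the (p h))}"
  have "finite {p. dom p = ?B \<and> ran p \<subseteq> A}"
    by (rule finite_set_of_finite_maps) (auto simp: fin)
  then have "finite ?F"
    by (rule rev_finite_subset) blast
  moreover have "\<forall>p\<in>?F. finite_pattern A p"
    by (auto simp: finite_pattern_def)
  moreover have "?X = {x \<in> UNIV \<rightarrow> A. \<forall>p\<in>?F. \<not> occurs_in p x}"
  proof (intro Collect_cong conj_cong refl iffI ballI allI notI)
    fix x p assume x: "\<forall>g. ok (shift g x)" and p: "p \<in> ?F" and o: "occurs_in p x"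
    obtain g where g: "\<forall>h\<in>dom p. p h = Some (x (g + h))"
      using o unfolding occurs_in_def by blast
    have "agree r (shift g x) (\<lambda>h. the (p h))"
      unfolding agree_def shift_def using g p by (auto simp: abs_le_iff)
    then show False
      using loc x p by blast
  next
    fix x g assume x: "x \<in> UNIV \<rightarrow> A" and h: "\<forall>p\<in>?F. \<not> occurs_in p x"
    show "ok (shift g x)"
    proof (rule ccontr)
      assume n: "\<not> ok (shift g x)"
      let ?p = "\<lambda>h. if h \<in> ?B then Some (x (g + h)) else None"
      have "agree r (\<lambda>h. the (?p h)) (shift g x)"
        unfolding agree_def shift_def by (auto simp: abs_le_iff)
      then have "\<not> ok (\<lambda>h. the (?p h))"
        using n loc by blast
      moreover have "dom ?p = ?B" "ran ?p \<subseteq> A"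
        using x by (auto simp: dom_def ran_def split: if_splits)
      ultimately have "?p \<in> ?F"
        by blast
      moreover have "occurs_in ?p x"
        unfolding occurs_in_def by (rule exI[of _ g]) (auto split: if_splits)
      ultimately show False
        using h by blast
    qed
  qed
  ultimately show ?thesis
    unfolding sft_def using sub by blast
qed

section \<open>Diamond islands\<close>

type_synonym shape = "int \<Rightarrow> int \<Rightarrow> nat"

abbreviation (input) grey :: nat where "grey \<equiv> 0"
abbreviation (input) up :: nat where "up \<equiv> 1"
abbreviation (input) down :: nat where "down \<equiv> 2"
abbreviation (input) mid :: nat where "mid \<equiv> 3"

text \<open>
  The row of \<open>mid\<close> cells is the horizontal diagonal of a diamond. The upper half consists of \<open>up\<close>
  cells and loses one cell on each side with every row, the lower half consists of \<open>down\<close> cells.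
  The diagonal has to be visible: without it, rectangles with sides of slope \<open>\<plusminus>1\<close> would also obey
  the rule, and their top and bottom corners may lie in different columns.
\<close>

definition triple :: "shape \<Rightarrow> nat \<Rightarrow> int \<Rightarrow> int \<Rightarrow> bool" where
  "triple s t i j \<longleftrightarrow> s (i - 1) j = t \<and> s i j = t \<and> s (i + 1) j = t"

text \<open>As equivalences, the first two clauses force a half to shrink by one cell per side and
  also forbid it to stop early. The third keeps a lower half from sitting directly on an upper half,
  so that a top and a bottom apex never compete for the same step; the fourth makes all cells of a
  run equal.\<close>

definition shape_rule :: "shape \<Rightarrow> int \<Rightarrow> int \<Rightarrow> bool" where
  "shape_rule s i j \<longleftrightarrow>
    (s i (j + 1) = up \<longleftrightarrow> triple s up i j \<or> triple s mid i j) \<and>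
    (s i (j - 1) = down \<longleftrightarrow> triple s down i j \<or> triple s mid i j) \<and>
    \<not> (s i j \<in> {up, mid} \<and> s i (j + 1) \<in> {down, mid}) \<and>
    (s i j \<noteq> grey \<and> s (i + 1) j \<noteq> grey \<longrightarrow> s i j = s (i + 1) j)"

definition valid :: "shape \<Rightarrow> bool" where
  "valid s \<longleftrightarrow> (\<forall>i j. s i j < 4 \<and> shape_rule s i j)"

definition top_apex :: "shape \<Rightarrow> int \<Rightarrow> int \<Rightarrow> bool" where
  "top_apex s i j \<longleftrightarrow> s i j \<in> {up, mid} \<and> s (i - 1) j = grey \<and> s (i + 1) j = grey"

definition bottom_apex :: "shape \<Rightarrow> int \<Rightarrow> int \<Rightarrow> bool" where
  "bottom_apex s i j \<longleftrightarrow> s i j \<in> {down, mid} \<and> s (i - 1) j = grey \<and> s (i + 1) j = grey"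

text \<open>
  In a diamond, the middle of the run of a row lies in the column of the two apexes. This
  description also covers the infinite islands, which need not have a \<open>mid\<close> row or a second apex.
\<close>

definition central :: "shape \<Rightarrow> int \<Rightarrow> int \<Rightarrow> bool" where
  "central s i j \<longleftrightarrow> s i j \<noteq> grey \<and>
    (\<exists>k::nat. (\<forall>a. \<bar>a\<bar> \<le> int k \<longrightarrow> s (i + a) j = s i j) \<and>
      s (i - int k - 1) j \<noteq> s i j \<and> s (i + int k + 1) j \<noteq> s i j)"

definition swap :: "nat \<Rightarrow> nat" where
  "swap t = (if t = up then down else if t = down then up else t)"

text \<open>The rule is symmetric under this reflection, which exchanges the halves of an island, so
  claims about lower halves follow from those about upper halves.\<close>

definition reflect :: "shape \<Rightarrow> shape" where
  "reflect s i j = swap (s i (- j))"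

lemma centralE:
  assumes "central s i j"
  obtains k :: nat where "\<forall>l. \<bar>l - i\<bar> \<le> int k \<longrightarrow> s l j = s i j"
    "s (i - int k - 1) j \<noteq> s i j" "s (i + int k + 1) j \<noteq> s i j" "s i j \<noteq> grey"
proof -
  obtain k :: nat where k: "\<forall>a. \<bar>a\<bar> \<le> int k \<longrightarrow> s (i + a) j = s i j"
    "s (i - int k - 1) j \<noteq> s i j" "s (i + int k + 1) j \<noteq> s i j" "s i j \<noteq> grey"
    using assms unfolding central_def by blast
  have "\<forall>l. \<bar>l - i\<bar> \<le> int k \<longrightarrow> s l j = s i j"
  proof (intro allI impI)
    fix l assume "\<bar>l - i\<bar> \<le> int k"
    then show "s l j = s i j"
      using spec[OF k(1), of "l - i"] by simp
  qed
  then show ?thesis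
    by (rule that[OF _ k(2,3,4)])
qed

lemma centralI:
  fixes k :: nat
  assumes "\<And>l. \<bar>l - i\<bar> \<le> int k \<Longrightarrow> s l j = s i j"
    "s (i - int k - 1) j \<noteq> s i j" "s (i + int k + 1) j \<noteq> s i j" "s i j \<noteq> grey"
  shows "central s i j"
  unfolding central_def
proof (intro conjI exI[of _ k] allI impI)
  show "s (i + a) j = s i j" if "\<bar>a\<bar> \<le> int k" for a
    by (rule assms(1)) (use that in simp)
qed (fact assms)+

lemma swap_swap [simp]: "swap (swap t) = t"
  by (simp add: swap_def)

lemma swap_inject [simp]: "swap t = swap t' \<longleftrightarrow> t = t'"
  by (auto simp: swap_def split: if_splits)

lemma swap_simps [simp]: "swap 0 = 0" "swap (Suc 0) = 2" "swap 2 = Suc 0" "swap 3 = 3"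
  by (simp_all add: swap_def)

lemma swap_eq_iff [simp]: "swap t = 0 \<longleftrightarrow> t = 0" "swap t = Suc 0 \<longleftrightarrow> t = 2"
  "swap t = 2 \<longleftrightarrow> t = Suc 0" "swap t = 3 \<longleftrightarrow> t = 3"
  by (auto simp: swap_def)

lemma swap_less_4 [simp]: "swap t < 4 \<longleftrightarrow> t < 4"
  by (auto simp: swap_def)

lemma reflect_reflect [simp]: "reflect (reflect s) = s"
  by (simp add: reflect_def fun_eq_iff)

lemma triple_reflect: "triple (reflect s) t i j \<longleftrightarrow> triple s (swap t) i (- j)"
proof -
  have "swap a = t \<longleftrightarrow> a = swap t" for a
    by auto
  then show ?thesis
    by (simp add: triple_def reflect_def)
qed

lemma validI:
  assumes "\<And>i j. s i j < 4"
    and "\<And>i j. s i (j + 1) = up \<longleftrightarrow> triple s up i j \<or> triple s mid i j"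
    and "\<And>i j. s i (j - 1) = down \<longleftrightarrow> triple s down i j \<or> triple s mid i j"
    and "\<And>i j. s i j \<in> {up, mid} \<Longrightarrow> s i (j + 1) \<in> {down, mid} \<Longrightarrow> False"
    and "\<And>i j. s i j \<noteq> grey \<Longrightarrow> s (i + 1) j \<noteq> grey \<Longrightarrow> s i j = s (i + 1) j"
  shows "valid s"
  unfolding valid_def shape_rule_def
proof (intro allI conjI impI notI)
  fix i j
  show "s i j < 4"
    by (rule assms(1))
  show "s i (j + 1) = up \<longleftrightarrow> triple s up i j \<or> triple s mid i j"
    by (rule assms(2))
  show "s i (j - 1) = down \<longleftrightarrow> triple s down i j \<or> triple s mid i j"
    by (rule assms(3))
  show False if "s i j \<in> {up, mid} \<and> s i (j + 1) \<in> {down, mid}"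
    by (rule assms(4)[OF conjunct1[OF that] conjunct2[OF that]])
  show "s i j = s (i + 1) j" if "s i j \<noteq> grey \<and> s (i + 1) j \<noteq> grey"
    by (rule assms(5)[OF conjunct1[OF that] conjunct2[OF that]])
qed

lemma validD:
  assumes "valid s"
  shows "s i j < 4"
    and "s i (j + 1) = up \<longleftrightarrow> triple s up i j \<or> triple s mid i j"
    and "s i (j - 1) = down \<longleftrightarrow> triple s down i j \<or> triple s mid i j"
    and "s i j \<in> {up, mid} \<Longrightarrow> s i (j + 1) \<notin> {down, mid}"
    and "s i j \<noteq> grey \<Longrightarrow> s (i + 1) j \<noteq> grey \<Longrightarrow> s i j = s (i + 1) j"
proof -
  have lt: "s i j < 4" and r: "shape_rule s i j"
    using assms by (simp_all add: valid_def)
  show "s i j < 4"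
    by (rule lt)
  note r = r[unfolded shape_rule_def]
  show "s i (j + 1) = up \<longleftrightarrow> triple s up i j \<or> triple s mid i j"
    by (rule r[THEN conjunct1])
  show "s i (j - 1) = down \<longleftrightarrow> triple s down i j \<or> triple s mid i j"
    by (rule r[THEN conjunct2, THEN conjunct1])
  show "s i j \<in> {up, mid} \<Longrightarrow> s i (j + 1) \<notin> {down, mid}"
    using r[THEN conjunct2, THEN conjunct2, THEN conjunct1] by blast
  show "s i j \<noteq> grey \<Longrightarrow> s (i + 1) j \<noteq> grey \<Longrightarrow> s i j = s (i + 1) j"
    using r[THEN conjunct2, THEN conjunct2, THEN conjunct2] by blast
qed

lemma row_neighbour:
  assumes "valid s" "s i j \<noteq> grey"
  shows "s (i + 1) j = grey \<or> s (i + 1) j = s i j" "s (i - 1) j = grey \<or> s (i - 1) j = s i j"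
  using validD(5)[OF assms] validD(5)[OF assms(1), of "i - 1" j] assms(2)
  by (metis, metis diff_add_cancel)

lemma valid_reflect:
  assumes "valid s"
  shows "valid (reflect s)"
proof (rule validI)
  note V = validD[OF assms]
  fix i j
  show "reflect s i j < 4"
    using V(1) by (simp add: reflect_def)
  show "reflect s i (j + 1) = up \<longleftrightarrow> triple (reflect s) up i j \<or> triple (reflect s) mid i j"
    using V(3)[of i "- j"] by (simp add: triple_reflect reflect_def)
  show "reflect s i (j - 1) = down \<longleftrightarrow> triple (reflect s) down i j \<or> triple (reflect s) mid i j"
    using V(2)[of i "- j"] by (simp add: triple_reflect reflect_def)
  show False if "reflect s i j \<in> {up, mid}" "reflect s i (j + 1) \<in> {down, mid}"
    using V(4)[of i "- (j + 1)"] that by (auto simp: reflect_def)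
  show "reflect s i j = reflect s (i + 1) j" if "reflect s i j \<noteq> grey" "reflect s (i + 1) j \<noteq> grey"
    using V(5)[of i "- j"] that by (simp add: reflect_def)
qed

lemma central_reflect: "central (reflect s) i j \<longleftrightarrow> central s i (- j)"
  by (simp add: central_def reflect_def)

lemma bottom_apex_reflect: "bottom_apex s i j \<longleftrightarrow> top_apex (reflect s) i (- j)"
  by (auto simp: bottom_apex_def top_apex_def reflect_def)

section \<open>How the middle of a run passes from row to row\<close>

lemma upD: "valid s \<Longrightarrow> s i (j + 1) = up \<Longrightarrow> s i j \<in> {up, mid} \<and> triple s (s i j) i j"
  using validD(2)[of s i j] by (auto simp: triple_def)

text \<open>The run of \<open>up\<close> cells in row \<open>j + 1\<close> is the run below it with
  one cell removed at each end, so both have the same middle, with radii differing by 1.\<close>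

lemma central_up:
  assumes v: "valid s" and u: "s i (j + 1) = up"
  shows "central s i j \<longleftrightarrow> central s i (j + 1)"
proof -
  define t where "t = s i j"
  have t: "t \<in> {up, mid}" and tri: "triple s t i j"
    using upD[OF v u] by (auto simp: t_def)
  have tri_up: "s l (j + 1) = up" if "triple s t l j" for l
    using validD(2)[OF v, of l j] that t by auto
  \<comment> \<open>Each \<open>up\<close> cell rests on a triple, so the value \<open>t\<close>
    spreads outwards from column \<open>i\<close> to one cell beyond the run above.\<close>
  have chain: "s l j = t"
    if k: "\<And>l. \<bar>l - i\<bar> \<le> int k \<Longrightarrow> s l (j + 1) = up" and l: "\<bar>l - i\<bar> \<le> int k + 1" for k l
  proof -
    have "n \<le> k + 1 \<longrightarrow> s (i + int n) j = t \<and> s (i - int n) j = t" for n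
    proof (induction n)
      case 0
      then show ?case by (simp add: t_def)
    next
      case (Suc n)
      show ?case
      proof
        assume n: "Suc n \<le> k + 1"
        then have "s (i + int n) j = t" "s (i - int n) j = t"
          using Suc by simp_all
        moreover have "s (i + int n) (j + 1) = up" "s (i - int n) (j + 1) = up"
          using k[of "i + int n"] k[of "i - int n"] n by simp_all
        ultimately have "triple s t (i + int n) j" "triple s t (i - int n) j"
          using upD[OF v] by metis+
        then show "s (i + int (Suc n)) j = t \<and> s (i - int (Suc n)) j = t"
          by (simp add: triple_def algebra_simps)
      qed
    qed
    from this[of "nat \<bar>l - i\<bar>"] l show ?thesis
      by (cases "l \<ge> i") auto
  qed
  show ?thesis
  proof
    assume "central s i j"
    then obtain k where k0: "\<forall>l. \<bar>l - i\<bar> \<le> int k \<longrightarrow> s l j = t"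
      and k23: "s (i - int k - 1) j \<noteq> t" "s (i + int k + 1) j \<noteq> t"
      unfolding t_def by (rule centralE)
    note k = k0[rule_format] k23
    have "s (i + 1) j = t"
      using tri by (simp add: triple_def)
    then obtain l where l: "k = Suc l"
      using k(3) by (cases k) auto
    show "central s i (j + 1)"
    proof (rule centralI)
      show "s i' (j + 1) = s i (j + 1)" if "\<bar>i' - i\<bar> \<le> int l" for i'
        unfolding u
      proof (rule tri_up)
        show "triple s t i' j"
          unfolding triple_def using that l by (intro conjI k(1)) auto
      qed
      have "\<not> triple s (s (i + int k) j) (i + int k) j" "\<not> triple s (s (i - int k) j) (i - int k) j"
        using k by (auto simp: triple_def)
      then have "s (i + int k) (j + 1) \<noteq> up" "s (i - int k) (j + 1) \<noteq> up"
        using upD[OF v] by blast+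
      moreover have eqs: "i - int l - 1 = i - int k" "i + int l + 1 = i + int k"
        by (simp_all add: l)
      ultimately show "s (i - int l - 1) (j + 1) \<noteq> s i (j + 1)" "s (i + int l + 1) (j + 1) \<noteq> s i (j + 1)"
        unfolding u eqs by blast+
    qed (simp add: u)
  next
    assume "central s i (j + 1)"
    then obtain k where k0: "\<forall>l. \<bar>l - i\<bar> \<le> int k \<longrightarrow> s l (j + 1) = s i (j + 1)"
      and k23: "s (i - int k - 1) (j + 1) \<noteq> s i (j + 1)" "s (i + int k + 1) (j + 1) \<noteq> s i (j + 1)"
      by (rule centralE)
    note k = k0[rule_format, unfolded u] k23[unfolded u]
    have c: "s l j = t" if "\<bar>l - i\<bar> \<le> int (Suc k)" for l
      using chain[where k = k and l = l] k(1) that by simp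
    have "\<not> triple s t (i + int k + 1) j" "\<not> triple s t (i - int k - 1) j"
      using tri_up k(2,3) by blast+
    then have n: "s (i + int (Suc k) + 1) j \<noteq> t" "s (i - int (Suc k) - 1) j \<noteq> t"
      using c[of "i + int k"] c[of "i - int k"] c[of "i + int k + 1"] c[of "i - int k - 1"]
      by (simp_all add: triple_def algebra_simps)
    show "central s i j"
      by (rule centralI[where k = "Suc k"]) (use c n t in \<open>auto simp: t_def[symmetric] simp del: of_nat_Suc\<close>)
  qed
qed

text \<open>A run of radius at least 1 contains a triple around its middle, which would force an
  \<open>up\<close> cell above it.\<close>

lemma central_top:
  assumes v: "valid s" and u: "s i j \<in> {up, mid}" "s i (j + 1) = grey"
  shows "central s i j \<longleftrightarrow> top_apex s i j"
proof
  assume "central s i j"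
  then obtain k where k0: "\<forall>l. \<bar>l - i\<bar> \<le> int k \<longrightarrow> s l j = s i j"
    and k23: "s (i - int k - 1) j \<noteq> s i j" "s (i + int k + 1) j \<noteq> s i j"
    by (rule centralE)
  note k = k0[rule_format] k23
  have "\<not> triple s (s i j) i j"
    using validD(2)[OF v, of i j] u by auto
  moreover have "triple s (s i j) i j" if "k \<ge> 1"
    unfolding triple_def using that by (intro conjI k(1)) auto
  ultimately have "k = 0"
    by linarith
  moreover have "s i j \<noteq> grey"
    using u by auto
  ultimately show "top_apex s i j"
    using k(2,3) u(1) row_neighbour[OF v, of i j] unfolding top_apex_def by simp
next
  assume "top_apex s i j"
  then show "central s i j"
    by (intro centralI[where k = 0]) (auto simp: top_apex_def)
qed

text \<open>Climbing a column, \<open>central\<close> is switched on at a bottom apex, off just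
  above a top apex, and nowhere else. Both events are visible locally, which lets a local rule on
  bits follow the invisible middle.\<close>

lemma central_step:
  assumes v: "valid s"
  shows "central s i j \<noteq> central s i (j + 1) \<longleftrightarrow> top_apex s i j \<or> bottom_apex s i (j + 1)"
proof -
  have half: "central s i j \<noteq> central s i (j + 1) \<longleftrightarrow> top_apex s i j \<or> bottom_apex s i (j + 1)"
    if v: "valid s" and s: "s i j \<in> {up, mid}" for s j
  proof -
    have "s i (j + 1) \<notin> {down, mid}"
      using validD(4)[OF v] s by blast
    then have "s i (j + 1) = grey \<or> s i (j + 1) = up"
      using validD(1)[OF v, of i "j + 1"] by auto
    then consider "s i (j + 1) = grey" | "s i (j + 1) = up"
      by (elim disjE)
    then show ?thesis
    proof cases
      case 1
      then show ?thesis
        using central_top[OF v s] by (simp add: bottom_apex_def central_def[of s i "j + 1"])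
    next
      case 2
      then have "\<not> top_apex s i j"
        using upD[OF v 2] by (auto simp: top_apex_def triple_def)
      then show ?thesis
        using 2 central_up[OF v 2] by (simp add: bottom_apex_def)
    qed
  qed
  consider "s i j \<in> {up, mid}" | "s i (j + 1) \<in> {down, mid}"
    | "s i j \<in> {grey, down}" "s i (j + 1) \<in> {grey, up}"
    using validD(1)[OF v, of i j] validD(1)[OF v, of i "j + 1"] by fastforce
  then show ?thesis
  proof cases
    case 1
    then show ?thesis
      using half v by blast
  next
    case 2
    then have r: "reflect s i (- (j + 1)) \<in> {up, mid}"
      unfolding reflect_def minus_minus by auto
    have "- (j + 1) + 1 = - j"
      by simp
    with half[OF valid_reflect[OF v] r]
    have "central s i (j + 1) \<noteq> central s i j \<longleftrightarrow>
        top_apex (reflect s) i (- (j + 1)) \<or> bottom_apex (reflect s) i (- j)"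
      by (simp only: central_reflect minus_minus)
    then show ?thesis
      unfolding bottom_apex_reflect reflect_reflect minus_minus by blast
  next
    case 3
    \<comment> \<open>An \<open>up\<close> cell needs support in the row below and a
      \<open>down\<close> cell in the row above; the values allowed here give none.\<close>
    have "s i j = grey" "s i (j + 1) = grey"
      using 3 upD[OF v, of i j] validD(3)[OF v, of i "j + 1"] by (auto simp: triple_def)
    then show ?thesis
      by (simp add: central_def top_apex_def bottom_apex_def)
  qed
qed

text \<open>Needed where a window sees only one run: at most one of its columns can be the hidden
  middle.\<close>

lemma central_unique:
  assumes "central s c j" "central s c' j" "c \<le> c'" and t: "\<And>i. c \<le> i \<Longrightarrow> i \<le> c' \<Longrightarrow> s i j = t"
  shows "c = c'"
proof -
  have eq: "s c j = t" "s c' j = t"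
    using t assms(3) by auto
  obtain k where k0: "\<forall>l. \<bar>l - c\<bar> \<le> int k \<longrightarrow> s l j = s c j"
    and k23: "s (c - int k - 1) j \<noteq> s c j" "s (c + int k + 1) j \<noteq> s c j"
    using assms(1) by (rule centralE)
  note k = k0[rule_format, unfolded eq] k23[unfolded eq]
  obtain k' where k0': "\<forall>l. \<bar>l - c'\<bar> \<le> int k' \<longrightarrow> s l j = s c' j"
    and k23': "s (c' - int k' - 1) j \<noteq> s c' j" "s (c' + int k' + 1) j \<noteq> s c' j"
    using assms(2) by (rule centralE)
  note k' = k0'[rule_format, unfolded eq] k23'[unfolded eq]
  have "\<not> (c \<le> c + int k + 1 \<and> c + int k + 1 \<le> c')" "\<not> (c \<le> c' - int k' - 1 \<and> c' - int k' - 1 \<le> c')"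
    using t k(3) k'(2) by blast+
  moreover have "\<not> \<bar>c + int k + 1 - c'\<bar> \<le> int k'" "\<not> \<bar>c - int k - 1 - c'\<bar> \<le> int k'"
    "\<not> \<bar>c' + int k' + 1 - c\<bar> \<le> int k" "\<not> \<bar>c' - int k' - 1 - c\<bar> \<le> int k"
    using k k' by blast+
  ultimately show ?thesis
    using assms(3) by linarith
qed

text \<open>A cell of another value at distance at most \<open>n\<close> bounds the radius, so both
  ends of a centred run are visible within distance \<open>n\<close>.\<close>

lemma central_determined:
  assumes agree: "\<And>l. \<bar>l - c\<bar> \<le> n \<Longrightarrow> s l j = s' l j"
    and i: "\<bar>i - c\<bar> \<le> n" "s i j \<noteq> s c j"
  shows "central s c j \<longleftrightarrow> central s' c j"
proof -
  have imp: "central s' c j" if "central s c j" and agree: "\<And>l. \<bar>l - c\<bar> \<le> n \<Longrightarrow> s l j = s' l j"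
    and ne: "s i j \<noteq> s c j" for s s'
  proof -
    obtain k where k0: "\<forall>l. \<bar>l - c\<bar> \<le> int k \<longrightarrow> s l j = s c j"
      and k23: "s (c - int k - 1) j \<noteq> s c j" "s (c + int k + 1) j \<noteq> s c j" "s c j \<noteq> grey"
      using \<open>central s c j\<close> by (rule centralE)
    note k = k0[rule_format] k23
    have "\<not> \<bar>i - c\<bar> \<le> int k"
      using k(1)[of i] ne by blast
    then have kn: "int k + 1 \<le> n"
      using i(1) by linarith
    have c: "s' c j = s c j"
      using agree[of c] kn by simp
    show ?thesis
    proof (rule centralI)
      show "s' l j = s' c j" if "\<bar>l - c\<bar> \<le> int k" for l
        using k(1)[OF that] agree[of l] that kn c by simp
      show "s' (c - int k - 1) j \<noteq> s' c j" "s' (c + int k + 1) j \<noteq> s' c j" "s' c j \<noteq> grey"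
        using k(2-4) agree[of "c - int k - 1"] agree[of "c + int k + 1"] kn c by simp_all
    qed
  qed
  have i': "s' i j \<noteq> s' c j"
    using agree[of c] agree[of i] i by auto
  show ?thesis
    using imp[of s s'] imp[of s' s] agree i(2) i' by metis
qed

section \<open>Finite diamonds\<close>

definition diamond :: "int \<Rightarrow> int \<Rightarrow> int \<Rightarrow> shape" where
  "diamond c p r i j =
    (if \<bar>i - c\<bar> + \<bar>j - p\<bar> \<le> r then if p < j then up else if j = p then mid else down else grey)"

lemma valid_diamond: "valid (diamond c p r)"
proof (rule validI)
  fix i j
  show "diamond c p r i j < 4"
    by (simp add: diamond_def)
  show "diamond c p r i (j + 1) = up \<longleftrightarrow> triple (diamond c p r) up i j \<or> triple (diamond c p r) mid i j"
    unfolding triple_def diamond_def by (auto split: if_splits)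
  show "diamond c p r i (j - 1) = down \<longleftrightarrow> triple (diamond c p r) down i j \<or> triple (diamond c p r) mid i j"
    unfolding triple_def diamond_def by (auto split: if_splits)
  show False if "diamond c p r i j \<in> {up, mid}" "diamond c p r i (j + 1) \<in> {down, mid}"
    using that by (auto simp: diamond_def split: if_splits)
  show "diamond c p r i j = diamond c p r (i + 1) j"
    if "diamond c p r i j \<noteq> grey" "diamond c p r (i + 1) j \<noteq> grey"
    using that by (auto simp: diamond_def split: if_splits)
qed

text \<open>A row \<open>j\<close> that meets the diamond does so in the run of radius
  \<open>r - \<bar>j - p\<bar>\<close> around column \<open>c\<close>.\<close>

lemma central_diamond: "central (diamond c p r) i j \<longleftrightarrow> i = c \<and> \<bar>j - p\<bar> \<le> r"
proof
  have nz: "diamond c p r i j \<noteq> grey \<longleftrightarrow> \<bar>i - c\<bar> + \<bar>j - p\<bar> \<le> r" for i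
    by (simp add: diamond_def)
  have same: "diamond c p r i' j = diamond c p r i j \<longleftrightarrow> diamond c p r i' j \<noteq> grey"
    if "diamond c p r i j \<noteq> grey" for i i'
    using that by (auto simp: diamond_def split: if_splits)
  {
    assume "central (diamond c p r) i j"
    then obtain k where k0: "\<forall>l. \<bar>l - i\<bar> \<le> int k \<longrightarrow> diamond c p r l j = diamond c p r i j"
      and k23: "diamond c p r (i - int k - 1) j \<noteq> diamond c p r i j"
        "diamond c p r (i + int k + 1) j \<noteq> diamond c p r i j"
      and g: "diamond c p r i j \<noteq> grey"
      by (rule centralE)
    note k = k0[rule_format, unfolded same[OF g]] k23[unfolded same[OF g]]
    have "\<not> \<bar>i - int k - 1 - c\<bar> + \<bar>j - p\<bar> \<le> r" "\<not> \<bar>i + int k + 1 - c\<bar> + \<bar>j - p\<bar> \<le> r"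
      using k(2,3) nz by metis+
    moreover have "\<bar>i + int k - c\<bar> + \<bar>j - p\<bar> \<le> r" "\<bar>i - int k - c\<bar> + \<bar>j - p\<bar> \<le> r"
      using k(1)[of "i + int k"] k(1)[of "i - int k"] nz by simp_all
    ultimately show "i = c \<and> \<bar>j - p\<bar> \<le> r"
      by linarith
  next
    assume h: "i = c \<and> \<bar>j - p\<bar> \<le> r"
    then have g: "diamond c p r i j \<noteq> grey"
      using nz by simp
    show "central (diamond c p r) i j"
    proof (rule centralI)
      define k where "k = nat (r - \<bar>j - p\<bar>)"
      have k: "int k = r - \<bar>j - p\<bar>"
        using h by (simp add: k_def)
      show "diamond c p r l j = diamond c p r i j" if "\<bar>l - i\<bar> \<le> int k" for l
        unfolding same[OF g] nz using that k h by linarith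
      show "diamond c p r (i - int k - 1) j \<noteq> diamond c p r i j"
        "diamond c p r (i + int k + 1) j \<noteq> diamond c p r i j"
        unfolding same[OF g] nz using k h by linarith+
    qed (rule g)
  }
qed

section \<open>Truncating infinite islands\<close>

text \<open>
  To cut an island below row \<open>q\<close>, its row \<open>q\<close> becomes the horizontal diagonal if it lies in the
  upper half, and the rows underneath are regenerated from row \<open>q\<close>.
\<close>

definition base :: "shape \<Rightarrow> int \<Rightarrow> int \<Rightarrow> nat" where
  "base s q i = (if s i q = up then mid else s i q)"

text \<open>The condition unrolls the \<open>down\<close> rule over \<open>q - j\<close> rows: the
  cone above the cell must meet row \<open>q\<close> in cells of a single value.\<close>

definition cut_below :: "shape \<Rightarrow> int \<Rightarrow> shape" where
  "cut_below s q i j =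
    (if q < j then s i j
     else if j = q then base s q i
     else if \<exists>t\<in>{down, mid}. \<forall>l. \<bar>l - i\<bar> \<le> q - j \<longrightarrow> base s q l = t then down
     else grey)"

lemma valid_cut_below:
  assumes v: "valid s"
  shows "valid (cut_below s q)"
proof (rule validI)
  note V = validD[OF v]
  let ?s = "cut_below s q"
  fix i j
  have above: "?s l m = s l m" if "q < m" for l m
    using that by (simp add: cut_below_def)
  have at: "?s l q = base s q l" for l
    by (simp add: cut_below_def)
  have below: "?s l m = down \<longleftrightarrow> (\<exists>t\<in>{down, mid}. \<forall>a. \<bar>a - l\<bar> \<le> q - m \<longrightarrow> base s q a = t)"
    "?s l m = down \<or> ?s l m = grey" if "m < q" for l m
    using that by (auto simp: cut_below_def)
  have below_ne: "?s l m \<noteq> up" "?s l m \<noteq> mid" if "m < q" for l m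
    using below(2)[OF that, of l] by auto
  have base_ne: "base s q l \<noteq> up" for l
    by (simp add: base_def)
  have base_row: "base s q l = base s q (l + 1)" if "base s q l \<noteq> grey" "base s q (l + 1) \<noteq> grey" for l
  proof -
    have "s l q \<noteq> grey" "s (l + 1) q \<noteq> grey"
      using that unfolding base_def by (simp_all split: if_splits)
    then show ?thesis
      using V(5)[of l q] by (simp add: base_def)
  qed
  have base_mid: "base s q l = mid \<longleftrightarrow> s l q \<in> {up, mid}" for l
    by (auto simp: base_def)
  show "?s i j < 4"
    using V(1)[of i j] by (auto simp: cut_below_def base_def)
  show "?s i (j + 1) = up \<longleftrightarrow> triple ?s up i j \<or> triple ?s mid i j"
  proof -
    consider "q < j" | "j = q" | "j < q"
      by linarith
    then show ?thesis
    proof cases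
      case 1
      then show ?thesis
        using V(2)[of i j] by (simp add: triple_def above)
    next
      case 2
      \<comment> \<open>Turning \<open>up\<close> into \<open>mid\<close> might have merged an
        \<open>up\<close> cell with a neighbouring \<open>mid\<close> cell;
        \<open>row_neighbour\<close> shows that these are never adjacent.\<close>
      have "triple ?s mid i q \<longleftrightarrow> triple s up i q \<or> triple s mid i q"
      proof
        assume "triple ?s mid i q"
        then have "s (i - 1) q \<in> {up, mid}" "s i q \<in> {up, mid}" "s (i + 1) q \<in> {up, mid}"
          by (auto simp: triple_def at base_mid)
        moreover from this have "s i q \<noteq> grey"
          by auto
        ultimately show "triple s up i q \<or> triple s mid i q"
          using row_neighbour[OF v, of i q] by (auto simp: triple_def)
      qed (auto simp: triple_def at base_mid)
      moreover have "\<not> triple ?s up i q"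
        using base_ne by (simp add: triple_def at)
      ultimately show ?thesis
        using 2 V(2)[of i q] above[of q] above[of "q + 1" i] by simp
    next
      case 3
      then have "?s i (j + 1) \<noteq> up"
        using below_ne(1)[of "j + 1" i] base_ne[of i] at[of i] by (cases "j + 1 = q") auto
      then show ?thesis
        using below_ne[OF 3, of i] by (simp add: triple_def)
    qed
  qed
  show "?s i (j - 1) = down \<longleftrightarrow> triple ?s down i j \<or> triple ?s mid i j"
  proof -
    consider "q + 1 < j" | "j = q + 1" | "j = q" | "j < q"
      by linarith
    then show ?thesis
    proof cases
      case 1
      then show ?thesis
        using V(3)[of i j] by (simp add: triple_def above)
    next
      case 2
      have "base s q i = down \<longleftrightarrow> s i q = down"
        by (auto simp: base_def)
      then show ?thesis
        using 2 V(3)[of i j] by (simp add: triple_def above at)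
    next
      case 3
      have "(\<forall>a. \<bar>a - i\<bar> \<le> 1 \<longrightarrow> base s q a = t) \<longleftrightarrow> triple ?s t i q" for t
      proof
        assume "triple ?s t i q"
        moreover have "a = i - 1 \<or> a = i \<or> a = i + 1" if "\<bar>a - i\<bar> \<le> 1" for a :: int
          using that by linarith
        ultimately show "\<forall>a. \<bar>a - i\<bar> \<le> 1 \<longrightarrow> base s q a = t"
          unfolding triple_def at by blast
      qed (simp add: triple_def at)
      then show ?thesis
        using 3 below(1)[of "q - 1" i] by simp
    next
      case 4
      define B where "B n l t \<longleftrightarrow> (\<forall>a. \<bar>a - l\<bar> \<le> n \<longrightarrow> base s q a = t)" for n l t
      have down_iff: "?s l m = down \<longleftrightarrow> B (q - m) l down \<or> B (q - m) l mid" if "m < q" for l m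
        using below(1)[OF that] by (simp add: B_def)
      \<comment> \<open>The intervals of radius \<open>q - j\<close> around three neighbouring
        columns together form the interval of radius \<open>q - j + 1\<close>.\<close>
      have B_iff: "B (q - (j - 1)) i t \<longleftrightarrow> B (q - j) (i - 1) t \<and> B (q - j) i t \<and> B (q - j) (i + 1) t" for t
      proof
        assume h: "B (q - j) (i - 1) t \<and> B (q - j) i t \<and> B (q - j) (i + 1) t"
        have "base s q a = t" if "\<bar>a - i\<bar> \<le> q - (j - 1)" for a
        proof -
          have "\<bar>a - (i - 1)\<bar> \<le> q - j \<or> \<bar>a - i\<bar> \<le> q - j \<or> \<bar>a - (i + 1)\<bar> \<le> q - j"
            using that 4 by linarith
          then show ?thesis
            using h unfolding B_def by blast
        qed
        then show "B (q - (j - 1)) i t"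
          by (simp add: B_def)
      qed (auto simp: B_def)
      \<comment> \<open>Since \<open>q - j \<ge> 1\<close>, all these intervals contain
        \<open>i\<close>, so a triple cannot mix cells regenerated from \<open>down\<close> with
        cells regenerated from \<open>mid\<close>.\<close>
      have det: "base s q i = t" if "\<bar>l - i\<bar> \<le> 1" "B (q - j) l t" for l t
        using that 4 by (simp add: B_def)
      have excl: "\<not> (B (q - j) l down \<and> B (q - j) l' mid)" if "\<bar>l - i\<bar> \<le> 1" "\<bar>l' - i\<bar> \<le> 1" for l l'
        using det[OF that(1), of down] det[OF that(2), of mid] by auto
      have "\<not> (B (q - j) (i - 1) down \<and> B (q - j) i mid)" "\<not> (B (q - j) i down \<and> B (q - j) (i - 1) mid)"
        "\<not> (B (q - j) (i + 1) down \<and> B (q - j) i mid)" "\<not> (B (q - j) i down \<and> B (q - j) (i + 1) mid)"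
        by (rule excl; simp)+
      then have "triple ?s down i j \<longleftrightarrow> (\<exists>t\<in>{down, mid}. B (q - (j - 1)) i t)"
        unfolding triple_def down_iff[OF 4] B_iff by blast
      then show ?thesis
        using 4 down_iff[of "j - 1" i] below_ne(2)[OF 4, of i] by (auto simp: triple_def)
    qed
  qed
  show False if "?s i j \<in> {up, mid}" "?s i (j + 1) \<in> {down, mid}"
  proof -
    have "\<not> j < q"
      using below_ne[of j i] that(1) by auto
    then have "q < j + 1"
      by simp
    moreover have "s i j \<in> {up, mid}"
      using that(1) above[of j i] at[of i] base_mid[of i] base_ne[of i] \<open>\<not> j < q\<close>
      by (cases "j = q") auto
    ultimately show False
      using that(2) V(4)[of i j] above[of "j + 1" i] by auto
  qed
  show "?s i j = ?s (i + 1) j" if "?s i j \<noteq> grey" "?s (i + 1) j \<noteq> grey"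
  proof -
    consider "q < j" | "j = q" | "j < q"
      by linarith
    then show ?thesis
    proof cases
      case 1
      then show ?thesis
        using that V(5)[of i j] by (simp add: above)
    next
      case 2
      then show ?thesis
        using that base_row by (simp add: at)
    next
      case 3
      then show ?thesis
        using that below(2) by metis
    qed
  qed
qed

lemma cut_below_above: "q < j \<Longrightarrow> cut_below s q i j = s i j"
  by (simp add: cut_below_def)

lemma cut_below_below: "j < q \<Longrightarrow> cut_below s q i j \<in> {grey, down}"
  by (simp add: cut_below_def)

text \<open>A vertical segment joins the cell to the diagonal in row \<open>p\<close>. This assigns
  cells to diagonals without a notion of connected component.\<close>

definition in_column :: "shape \<Rightarrow> int \<Rightarrow> int \<Rightarrow> int \<Rightarrow> bool" where
  "in_column s p i j \<longleftrightarrow> s i p = mid \<and> (\<forall>q. p < q \<and> q \<le> j \<longrightarrow> s i q = up) \<and>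
    (\<forall>q. j \<le> q \<and> q < p \<longrightarrow> s i q = down)"

text \<open>Each island is intersected with the diamond of radius \<open>r\<close> centred in column
  0 of the island's own diagonal row. Shapes with a common diagonal row and sides of slope 1 and -1
  are closed under intersection, so the rule survives.\<close>

definition kept :: "shape \<Rightarrow> int \<Rightarrow> int \<Rightarrow> int \<Rightarrow> bool" where
  "kept s r i j \<longleftrightarrow> (\<exists>p. in_column s p i j \<and> \<bar>i\<bar> + \<bar>j - p\<bar> \<le> r)"

definition cut_sides :: "shape \<Rightarrow> int \<Rightarrow> shape" where
  "cut_sides s r i j = (if kept s r i j then s i j else grey)"

lemma in_column_reflect: "in_column (reflect s) p i j \<longleftrightarrow> in_column s (- p) i (- j)"
proof -
  have imp: "in_column s (- p) i (- j)" if h: "in_column (reflect s) p i j" for s p j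
    unfolding in_column_def
  proof (intro conjI allI impI)
    show "s i (- p) = mid"
      using h by (simp add: in_column_def reflect_def)
    show "s i q = up" if "- p < q \<and> q \<le> - j" for q
    proof -
      have "j \<le> - q \<and> - q < p"
        using that by linarith
      then have "reflect s i (- q) = down"
        using h unfolding in_column_def by blast
      then show ?thesis
        by (simp add: reflect_def)
    qed
    show "s i q = down" if "- j \<le> q \<and> q < - p" for q
    proof -
      have "p < - q \<and> - q \<le> j"
        using that by linarith
      then have "reflect s i (- q) = up"
        using h unfolding in_column_def by blast
      then show ?thesis
        by (simp add: reflect_def)
    qed
  qed
  show ?thesis
    using imp[of s p j] imp[of "reflect s" "- p" "- j"] by auto
qed

lemma cut_sides_reflect: "cut_sides (reflect s) r = reflect (cut_sides s r)"
proof -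
  have "kept (reflect s) r i j \<longleftrightarrow> kept s r i (- j)" for i j
  proof
    assume "kept (reflect s) r i j"
    then obtain p where "in_column s (- p) i (- j)" "\<bar>i\<bar> + \<bar>j - p\<bar> \<le> r"
      by (auto simp: kept_def in_column_reflect)
    then show "kept s r i (- j)"
      unfolding kept_def by (intro exI[of _ "- p"]) auto
  next
    assume "kept s r i (- j)"
    then obtain p where "in_column s p i (- j)" "\<bar>i\<bar> + \<bar>- j - p\<bar> \<le> r"
      by (auto simp: kept_def)
    then show "kept (reflect s) r i j"
      unfolding kept_def in_column_reflect by (intro exI[of _ "- p"]) auto
  qed
  then show ?thesis
    by (simp add: fun_eq_iff cut_sides_def reflect_def)
qed

text \<open>Follow column \<open>i\<close> down from the \<open>up\<close> cell: each cell above row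
  \<open>p\<close> rests on a triple, so the neighbouring columns copy it all the way to the
  diagonal.\<close>

lemma in_column_up_row:
  assumes v: "valid s" and p: "in_column s p i (j + 1)" and u: "s i (j + 1) = up"
    and l: "\<bar>l - i\<bar> \<le> 1"
  shows "in_column s p l j" "p \<le> j" "s l j = s i j"
proof -
  have pj: "p \<le> j"
  proof (rule ccontr)
    assume "\<not> p \<le> j"
    then consider "p = j + 1" | "j + 1 < p"
      by linarith
    then show False
      using p u by cases (auto simp: in_column_def)
  qed
  have same: "s l q = s i q" if "p \<le> q" "q \<le> j" for q
  proof -
    have "s i (q + 1) = up"
      using p that by (auto simp: in_column_def)
    moreover have "l = i - 1 \<or> l = i \<or> l = i + 1"
      using l by linarith
    ultimately show ?thesis
      using upD[OF v, of i q] by (auto simp: triple_def)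
  qed
  show "in_column s p l j" "p \<le> j" "s l j = s i j"
    using p same pj by (auto simp: in_column_def)
qed

lemma in_column_unique:
  assumes "in_column s p i j" "in_column s q i j" "s i j \<in> {up, mid}"
  shows "p = q"
proof -
  have le: "p \<le> j" if "in_column s p i j" for p
  proof (rule ccontr)
    assume "\<not> p \<le> j"
    then have "s i j = down"
      using that by (simp add: in_column_def)
    then show False
      using assms(3) by simp
  qed
  have False if "in_column s p i j" "in_column s q i j" "p < q" for p q
  proof -
    have "s i q = up" "s i q = mid"
      using that le[OF that(2)] by (auto simp: in_column_def)
    then show False by simp
  qed
  then show ?thesis
    using assms(1,2) by (metis linorder_neqE)
qed

text \<open>For \<open>p \<le> j\<close>, the point \<open>(i, j + 1)\<close> lies in the ball
  around \<open>(0, p)\<close> iff both \<open>(i - 1, j)\<close> and \<open>(i + 1, j)\<close> do,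
  as the larger of \<open>\<bar>i - 1\<bar>\<close> and \<open>\<bar>i + 1\<bar>\<close> is
  \<open>\<bar>i\<bar> + 1\<close>. What remains is that all these cells refer to the same
  \<open>p\<close>.\<close>

lemma up_rule_cut_sides:
  assumes v: "valid s"
  shows "cut_sides s r i (j + 1) = up \<longleftrightarrow> triple (cut_sides s r) up i j \<or> triple (cut_sides s r) mid i j"
proof
  assume "cut_sides s r i (j + 1) = up"
  then have u: "s i (j + 1) = up" and k: "kept s r i (j + 1)"
    by (auto simp: cut_sides_def split: if_splits)
  obtain p where p: "in_column s p i (j + 1)" and b: "\<bar>i\<bar> + \<bar>j + 1 - p\<bar> \<le> r"
    using k by (auto simp: kept_def)
  have c: "cut_sides s r l j = s i j" if l: "\<bar>l - i\<bar> \<le> 1" for l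
  proof -
    note c = in_column_up_row[OF v p u l]
    have "\<bar>l\<bar> + \<bar>j - p\<bar> \<le> r"
      using b c(2) l by linarith
    then have "kept s r l j"
      using c(1) unfolding kept_def by blast
    then show ?thesis
      using c(3) by (simp add: cut_sides_def)
  qed
  have "triple (cut_sides s r) (s i j) i j"
    by (simp add: triple_def c)
  then show "triple (cut_sides s r) up i j \<or> triple (cut_sides s r) mid i j"
    using upD[OF v u] by auto
next
  assume "triple (cut_sides s r) up i j \<or> triple (cut_sides s r) mid i j"
  then obtain t where t: "t \<in> {up, mid}" "triple (cut_sides s r) t i j"
    by blast
  have k: "kept s r l j \<and> s l j = t" if "\<bar>l - i\<bar> \<le> 1" for l
  proof -
    have "l = i - 1 \<or> l = i \<or> l = i + 1"
      using that by linarith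
    then have "cut_sides s r l j = t"
      using t(2) by (auto simp: triple_def)
    then show ?thesis
      using t(1) by (auto simp: cut_sides_def split: if_splits)
  qed
  then have "triple s t i j"
    by (simp add: triple_def)
  then have u: "s i (j + 1) = up"
    using validD(2)[OF v, of i j] t(1) by auto
  obtain p where p: "in_column s p i j"
    using k[of i] by (auto simp: kept_def)
  have pj: "p \<le> j"
  proof (rule ccontr)
    assume "\<not> p \<le> j"
    then have "s i j = down"
      using p by (simp add: in_column_def)
    then show False
      using k[of i] t(1) by auto
  qed
  have "q \<le> j \<or> q = j + 1" if "q \<le> j + 1" for q :: int
    using that by linarith
  then have p1: "in_column s p i (j + 1)"
    using p u pj unfolding in_column_def by (metis add_le_cancel_left linorder_not_less zless_add1_eq)
  have b: "\<bar>l\<bar> + \<bar>j - p\<bar> \<le> r" if l: "\<bar>l - i\<bar> \<le> 1" for l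
  proof -
    obtain q where q: "in_column s q l j" "\<bar>l\<bar> + \<bar>j - q\<bar> \<le> r"
      using k[OF l] by (auto simp: kept_def)
    have "s l j \<in> {up, mid}"
      using k[OF l] t(1) by blast
    then have "q = p"
      by (rule in_column_unique[OF q(1) in_column_up_row(1)[OF v p1 u l]])
    then show ?thesis
      using q(2) by simp
  qed
  have "\<bar>i - 1\<bar> + \<bar>j - p\<bar> \<le> r" "\<bar>i + 1\<bar> + \<bar>j - p\<bar> \<le> r"
    using b by simp_all
  then have "\<bar>i\<bar> + \<bar>j + 1 - p\<bar> \<le> r"
    using pj by linarith
  then have "kept s r i (j + 1)"
    using p1 unfolding kept_def by blast
  then show "cut_sides s r i (j + 1) = up"
    using u by (simp add: cut_sides_def)
qed

lemma valid_cut_sides: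
  assumes v: "valid s"
  shows "valid (cut_sides s r)"
proof (rule validI)
  note V = validD[OF v]
  fix i j
  show "cut_sides s r i j < 4"
    using V(1)[of i j] by (simp add: cut_sides_def)
  show "cut_sides s r i (j + 1) = up \<longleftrightarrow> triple (cut_sides s r) up i j \<or> triple (cut_sides s r) mid i j"
    by (rule up_rule_cut_sides[OF v])
  have e: "- j + 1 = - (j - 1)"
    by simp
  show "cut_sides s r i (j - 1) = down \<longleftrightarrow> triple (cut_sides s r) down i j \<or> triple (cut_sides s r) mid i j"
    using up_rule_cut_sides[OF valid_reflect[OF v], of r i "- j"]
    unfolding cut_sides_reflect triple_reflect e by (simp add: reflect_def)
  show False if "cut_sides s r i j \<in> {up, mid}" "cut_sides s r i (j + 1) \<in> {down, mid}"
    using that V(4)[of i j] by (auto simp: cut_sides_def split: if_splits)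
  show "cut_sides s r i j = cut_sides s r (i + 1) j"
    if "cut_sides s r i j \<noteq> grey" "cut_sides s r (i + 1) j \<noteq> grey"
    using that V(5)[of i j] by (auto simp: cut_sides_def split: if_splits)
qed

text \<open>Descend to the first cell that is not \<open>up\<close>. It exists by
  \<open>low\<close>, and it is \<open>mid\<close> because it carries an \<open>up\<close> cell or
  is the start itself.\<close>

lemma in_column_exists_up:
  assumes v: "valid s" and u: "s i j \<in> {up, mid}" and low: "\<And>q. q < b \<Longrightarrow> s i q \<notin> {up, mid}"
  obtains p where "in_column s p i j" "b \<le> p" "p \<le> j"
proof -
  define n where "n = (LEAST n. s i (j - int n) \<noteq> up)"
  have "\<exists>n. s i (j - int n) \<noteq> up"
    using low[of "j - int (nat (j - b + 1))"] by (intro exI[of _ "nat (j - b + 1)"]) auto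
  then have n: "s i (j - int n) \<noteq> up"
    unfolding n_def by (rule LeastI_ex)
  have l: "s i (j - int m) = up" if "m < n" for m
    using not_less_Least that unfolding n_def by blast
  have "s i (j - int n) = mid"
  proof (cases n)
    case 0
    then show ?thesis
      using n u by auto
  next
    case (Suc m)
    then have "s i (j - int n + 1) = up"
      using l[of m] by simp
    then show ?thesis
      using upD[OF v, of i "j - int n"] n by auto
  qed
  moreover have "s i q = up" if "j - int n < q" "q \<le> j" for q
    using l[of "nat (j - q)"] that by simp
  ultimately have "in_column s (j - int n) i j"
    by (auto simp: in_column_def)
  moreover have "b \<le> j - int n"
    using low \<open>s i (j - int n) = mid\<close> by (metis insertCI linorder_not_less)
  ultimately show ?thesis
    using that by simp
qed

lemma in_column_exists:
  assumes v: "valid s" and nz: "s i j \<noteq> grey"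
    and low: "\<And>q. q < - b \<Longrightarrow> s i q \<notin> {up, mid}" and high: "\<And>q. b < q \<Longrightarrow> s i q \<notin> {down, mid}"
  obtains p where "in_column s p i j" "- b \<le> p" "p \<le> b"
proof -
  have mid: "s i p = mid" if "in_column s p i j" for p
    using that by (simp add: in_column_def)
  have bounds: "- b \<le> p" "p \<le> b" if "in_column s p i j" for p
    using low[of p] high[of p] mid[OF that] by (metis insertCI linorder_not_less)+
  have "s i j \<in> {up, mid} \<or> s i j = down"
    using nz validD(1)[OF v, of i j] by auto
  then show ?thesis
  proof
    assume "s i j \<in> {up, mid}"
    then obtain p where "in_column s p i j"
      using in_column_exists_up[OF v _ low] by metis
    then show ?thesis
      using that bounds by blast
  next
    assume "s i j = down"
    then have "reflect s i (- j) \<in> {up, mid}"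
      by (simp add: reflect_def)
    moreover have "reflect s i q \<notin> {up, mid}" if "q < - b" for q
      using high[of "- q"] that by (auto simp: reflect_def)
    ultimately obtain p where "in_column (reflect s) p i (- j)"
      using in_column_exists_up[OF valid_reflect[OF v], of i "- j" "- b"] by metis
    then have "in_column s (- p) i j"
      by (simp add: in_column_reflect)
    then show ?thesis
      using that bounds by blast
  qed
qed

text \<open>The horizontal cuts come first: they give every remaining island a diagonal in a row
  from \<open>- K\<close> to \<open>K\<close>. Without them \<open>cut_sides\<close> would erase
  islands that have no diagonal, such as the plane filled with \<open>up\<close>.\<close>

lemma finite_truncation:
  assumes v: "valid s"
  obtains s' L where "valid s'" "\<And>i j. \<bar>i\<bar> \<le> m \<Longrightarrow> \<bar>j\<bar> \<le> m \<Longrightarrow> s' i j = s i j"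
    "\<And>i j. s' i j \<noteq> grey \<Longrightarrow> \<bar>i\<bar> \<le> L \<and> \<bar>j\<bar> \<le> L"
proof -
  \<comment> \<open>One more than the radius, since a cut may change its own row.\<close>
  define K where "K = \<bar>m\<bar> + 1"
  define s1 where "s1 = cut_below s (- K)"
  define s2 where "s2 = reflect (cut_below (reflect s1) (- K))"
  \<comment> \<open>Bounds \<open>\<bar>i\<bar> + \<bar>j\<bar> + \<bar>p\<bar>\<close> for cells of
    the window and diagonal rows with \<open>\<bar>p\<bar> \<le> K\<close>.\<close>
  define r where "r = 2 * \<bar>m\<bar> + K"
  have v1: "valid s1"
    unfolding s1_def by (rule valid_cut_below[OF v])
  have v2: "valid s2"
    unfolding s2_def by (intro valid_reflect valid_cut_below v1)
  have s2_eq: "s2 i j = s1 i j" if "j < K" for i j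
    using that by (simp add: s2_def reflect_def cut_below_above)
  have high: "s2 i q \<notin> {down, mid}" if "K < q" for i q
    using cut_below_below[of "- q" "- K" "reflect s1" i] that by (auto simp: s2_def reflect_def)
  have low: "s2 i q \<notin> {up, mid}" if "q < - K" for i q
    using cut_below_below[of q "- K" s i] that s2_eq[of q i] by (auto simp: s1_def K_def)
  have agree: "s2 i j = s i j" if "\<bar>i\<bar> \<le> m" "\<bar>j\<bar> \<le> m" for i j
  proof -
    have "- K < j" "j < K"
      using that by (auto simp: K_def)
    then show ?thesis
      by (simp add: s2_eq s1_def cut_below_above)
  qed
  show ?thesis
  proof (rule that[of "cut_sides s2 r" "r + K"])
    show "valid (cut_sides s2 r)"
      by (rule valid_cut_sides[OF v2])
    show "cut_sides s2 r i j = s i j" if ij: "\<bar>i\<bar> \<le> m" "\<bar>j\<bar> \<le> m" for i j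
    proof (cases "s2 i j = grey")
      case True
      then show ?thesis
        using agree[OF ij] by (simp add: cut_sides_def)
    next
      case False
      obtain p where p: "in_column s2 p i j" "- K \<le> p" "p \<le> K"
        by (rule in_column_exists[OF v2 False low high]) auto
      have "\<bar>i\<bar> + \<bar>j - p\<bar> \<le> r"
        using ij p by (auto simp: r_def)
      then have "kept s2 r i j"
        using p unfolding kept_def by blast
      then show ?thesis
        using agree[OF ij] by (simp add: cut_sides_def)
    qed
    show "\<bar>i\<bar> \<le> r + K \<and> \<bar>j\<bar> \<le> r + K" if "cut_sides s2 r i j \<noteq> grey" for i j
    proof -
      have "kept s2 r i j"
        using that by (auto simp: cut_sides_def split: if_splits)
      then obtain p where p: "in_column s2 p i j" "\<bar>i\<bar> + \<bar>j - p\<bar> \<le> r"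
        by (auto simp: kept_def)
      have "s2 i p = mid"
        using p by (simp add: in_column_def)
      then have "- K \<le> p" "p \<le> K"
        using low[of p i] high[of p i] by (metis insertCI linorder_not_less)+
      moreover have "K \<ge> 0"
        by (simp add: K_def)
      ultimately show ?thesis
        using p(2) by linarith
    qed
  qed
qed

section \<open>The subshift of islands\<close>

text \<open>A symbol below 8 encodes a shape and a bit as \<open>2 * shape + bit\<close>.\<close>

definition sh :: "nat config \<Rightarrow> shape" where
  "sh x i j = x (i, j) div 2"

definition bt :: "nat config \<Rightarrow> int \<Rightarrow> int \<Rightarrow> bool" where
  "bt x i j \<longleftrightarrow> odd (x (i, j))"

definition local_rule :: "nat config \<Rightarrow> bool" where
  "local_rule x \<longleftrightarrow> shape_rule (sh x) 0 0 \<and>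
    (bt x 0 0 \<noteq> bt x 0 1 \<longleftrightarrow> top_apex (sh x) 0 0 \<or> bottom_apex (sh x) 0 1)"

definition islands :: "nat config set" where
  "islands = {x \<in> UNIV \<rightarrow> {0..<8}. \<forall>g. local_rule (shift g x)}"

text \<open>By \<open>outer_row\<close> every point of \<open>islands\<close> has this form, with
  \<open>outer\<close> in the place of \<open>V\<close>: a point is a valid shape together with a
  free choice of one bit per column.\<close>

definition conf :: "shape \<Rightarrow> (int \<Rightarrow> bool) \<Rightarrow> nat config" where
  "conf s V = (\<lambda>(i, j). 2 * s i j + of_bool (V i \<noteq> central s i j))"

text \<open>
  For a point of the subshift, \<open>outer x c\<close> is the bit that column \<open>c\<close> shows outside the islands. Row
  0 is an arbitrary choice, and the formula makes sense even if column \<open>c\<close> has no grey cell.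
\<close>

definition outer :: "nat config \<Rightarrow> int \<Rightarrow> bool" where
  "outer x c \<longleftrightarrow> bt x c 0 \<noteq> central (sh x) c 0"

abbreviation flat :: "(int \<Rightarrow> bool) \<Rightarrow> nat config" where
  "flat \<equiv> conf (\<lambda>_ _. grey)"

lemma local_rule_agree:
  assumes "agree 1 x y" "local_rule x"
  shows "local_rule y"
proof -
  have eq: "x (i, j) = y (i, j)" if "\<bar>i\<bar> \<le> 1" "\<bar>j\<bar> \<le> 1" for i j
    using assms(1) that by (simp add: agree_def)
  have "sh x i j = sh y i j" "bt x i j = bt y i j" if "\<bar>i\<bar> \<le> 1" "\<bar>j\<bar> \<le> 1" for i j
    using eq[OF that] by (simp_all add: sh_def bt_def)
  then show ?thesis
    using assms(2)
    unfolding local_rule_def shape_rule_def triple_def top_apex_def bottom_apex_def by simp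
qed

lemma sft_islands: "sft {0..<8} islands"
  unfolding islands_def using local_rule_agree by (intro sft_if_local_rule) auto

lemma closed_islands: "closed islands"
  using sft_islands by (simp add: sft_def subshift_def)

lemma shift_islands: "x \<in> islands \<Longrightarrow> shift g x \<in> islands"
  using sft_islands unfolding sft_def subshift_def by blast

lemma local_rule_shift:
  "local_rule (shift (a, b) x) \<longleftrightarrow> shape_rule (sh x) a b \<and>
    (bt x a b \<noteq> bt x a (b + 1) \<longleftrightarrow> top_apex (sh x) a b \<or> bottom_apex (sh x) a (b + 1))"
  by (simp add: local_rule_def shape_rule_def triple_def top_apex_def bottom_apex_def sh_def bt_def shift_def)

lemma sh_conf [simp]: "sh (conf s V) = s"
  by (simp add: sh_def conf_def fun_eq_iff)

lemma bt_conf [simp]: "bt (conf s V) i j \<longleftrightarrow> V i \<noteq> central s i j"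
  by (simp add: bt_def conf_def)

lemma conf_in_islands:
  assumes "valid s"
  shows "conf s V \<in> islands"
proof -
  have "local_rule (shift g (conf s V))" for g
    using assms central_step[OF assms] by (cases g) (auto simp: local_rule_shift valid_def)
  moreover have "conf s V (i, j) < 8" for i j
    using validD(1)[OF assms, of i j] by (simp add: conf_def of_bool_def)
  ultimately show ?thesis
    by (auto simp: islands_def)
qed

lemma islands_valid:
  assumes "x \<in> islands"
  shows "valid (sh x)"
proof -
  have "x (i, j) < 8" for i j
    using assms by (auto simp: islands_def Pi_iff)
  then have "sh x i j < 4" for i j
    by (simp add: sh_def less_mult_imp_div_less)
  moreover have "shape_rule (sh x) i j" for i j
    using assms local_rule_shift[of i j x] by (auto simp: islands_def)
  ultimately show ?thesis
    by (simp add: valid_def)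
qed

text \<open>Along a column, the bit and \<open>central\<close> change at the same steps, by the
  local rule and by \<open>central_step\<close>, so their difference is constant.\<close>

lemma outer_row:
  assumes "x \<in> islands"
  shows "outer x c \<longleftrightarrow> bt x c j \<noteq> central (sh x) c j"
proof -
  define o' where "o' j \<longleftrightarrow> bt x c j \<noteq> central (sh x) c j" for j
  have "(bt x c j \<noteq> bt x c (j + 1)) \<longleftrightarrow> (central (sh x) c j \<noteq> central (sh x) c (j + 1))" for j
    using assms local_rule_shift[of c j x] central_step[OF islands_valid[OF assms], of c j]
    by (auto simp: islands_def)
  then have step: "o' (j + 1) = o' j" for j
    unfolding o'_def by blast
  have "o' j = o' 0"
  proof (induction j rule: int_induct[where k = 0])
    case (step1 i)
    then show ?case using step by simp
  next
    case (step2 i)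
    then show ?case using step[of "i - 1"] by simp
  qed simp
  then show ?thesis
    by (simp add: outer_def o'_def)
qed

lemma outer_conf: "outer (conf s V) = V"
  by (auto simp: outer_def)

lemma central_shift: "central (\<lambda>i j. s (a + i) (b + j)) i j \<longleftrightarrow> central s (a + i) (b + j)"
  by (simp add: central_def algebra_simps)

text \<open>The vertical part \<open>b\<close> of the shift leaves no trace, so windows at different
  heights of a column test the same bits.\<close>

lemma outer_shift:
  assumes "x \<in> islands"
  shows "outer (shift (a, b) x) c \<longleftrightarrow> outer x (a + c)"
proof -
  have "sh (shift (a, b) x) = (\<lambda>i j. sh x (a + i) (b + j))" "bt (shift (a, b) x) c 0 = bt x (a + c) b"
    by (simp_all add: sh_def bt_def shift_def fun_eq_iff)
  then show ?thesis
    using outer_row[OF assms, of "a + c" b] central_shift[of "sh x" a b c 0] by (simp add: outer_def)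
qed

lemma conf_outside:
  assumes "\<And>i j. s i j \<noteq> grey \<Longrightarrow> \<bar>i\<bar> \<le> L \<and> \<bar>j\<bar> \<le> L" "\<bar>i\<bar> > L \<or> \<bar>j\<bar> > L"
  shows "conf s V (i, j) = of_bool (V i)"
proof -
  have "s i j = grey"
    using assms by (metis linorder_not_less)
  then show ?thesis
    by (simp add: conf_def central_def)
qed

section \<open>Gluing points along a sublattice\<close>

lemma valid_flat: "valid (\<lambda>_ _. grey)"
  by (rule validI) (auto simp: triple_def)

lemma flat_apply: "flat V (i, j) = of_bool (V i)"
  by (simp add: conf_def central_def)

text \<open>Two points with the same background outside a box are placed on a lattice in the
  arbitrary pattern \<open>\<phi>\<close>. The background depends on the column alone, so sharing
  \<open>V\<close> makes all choices compatible.\<close>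

locale gluing =
  fixes L :: int and x1 x2 :: "nat config" and V :: "int \<Rightarrow> bool" and \<phi> :: "int \<times> int \<Rightarrow> bool"
  assumes L: "L \<ge> 0" and x: "x1 \<in> islands" "x2 \<in> islands"
    and out: "\<And>i j. \<bar>i\<bar> > L \<or> \<bar>j\<bar> > L \<Longrightarrow> x1 (i, j) = of_bool (V i)"
      "\<And>i j. \<bar>i\<bar> > L \<or> \<bar>j\<bar> > L \<Longrightarrow> x2 (i, j) = of_bool (V i)"
begin

text \<open>Blocks have radius \<open>L + 2\<close>: the margin of two cells ensures that a 3 by 3
  square either stays in one block or misses all boxes of radius \<open>L\<close>.\<close>

definition N :: int where "N = 2 * L + 5"
definition blk :: "int \<Rightarrow> int" where "blk t = (t + L + 2) div N"
definition pos :: "int \<Rightarrow> int" where "pos t = (t + L + 2) mod N - (L + 2)"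

definition glued :: "nat config" where
  "glued = (\<lambda>(i, j). (if \<phi> (blk i, blk j) then x1 else x2) (pos i, pos j))"

lemma blk_pos: "t = N * blk t + pos t"
  unfolding blk_def pos_def using mult_div_mod_eq[of N "t + L + 2"] by linarith

lemma blk_pos_unique:
  assumes "\<bar>r\<bar> \<le> L + 2"
  shows "blk (N * a + r) = a" "pos (N * a + r) = r"
proof -
  have e: "N * a + r + L + 2 = N * a + (r + L + 2)" "0 \<le> r + L + 2" "r + L + 2 < N"
    using assms by (auto simp: N_def)
  show "blk (N * a + r) = a" "pos (N * a + r) = r"
    unfolding blk_def pos_def int_div_pos_eq[OF e] int_mod_pos_eq[OF e] by simp_all
qed

lemma inside_step:
  assumes "\<bar>pos t\<bar> \<le> L + 1" "\<bar>d\<bar> \<le> 1"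
  shows "blk (t + d) = blk t" "pos (t + d) = pos t + d"
proof -
  have "t + d = N * blk t + (pos t + d)"
    using blk_pos[of t] by simp
  moreover have "\<bar>pos t + d\<bar> \<le> L + 2"
    using assms by linarith
  ultimately show "blk (t + d) = blk t" "pos (t + d) = pos t + d"
    using blk_pos_unique by metis+
qed

lemma boundary_step:
  assumes "\<bar>pos t\<bar> > L + 1" "\<bar>d\<bar> \<le> 1"
  shows "\<bar>pos (t + d)\<bar> > L"
proof -
  have "\<bar>pos (t + d)\<bar> \<le> L + 1 \<Longrightarrow> pos (t + d + - d) = pos (t + d) + - d"
    by (rule inside_step(2)) (use assms(2) in auto)
  then show ?thesis
    using assms by fastforce
qed

text \<open>A 3 by 3 square inside one block is a square of \<open>x1\<close> or \<open>x2\<close>;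
  one that misses the boxes is a square of the flat point with the periodic bits
  \<open>V (pos t)\<close>.\<close>

lemma glued_in_islands: "glued \<in> islands"
proof -
  define w where "w p = (if \<phi> p then x1 else x2)" for p
  have w: "w p \<in> islands" for p
    using x by (simp add: w_def)
  have w_out: "w p (i, j) = of_bool (V i)" if "\<bar>i\<bar> > L \<or> \<bar>j\<bar> > L" for p i j
    using out that by (simp add: w_def)
  have g: "glued (i, j) = w (blk i, blk j) (pos i, pos j)" for i j
    by (simp add: glued_def w_def)
  have "glued p \<in> {0..<8}" for p
    using w[of "(blk (fst p), blk (snd p))"] g[of "fst p" "snd p"]
    by (auto simp: islands_def Pi_iff)
  moreover have "local_rule (shift p glued)" for p
  proof -
    obtain i j where p: "p = (i, j)"
      by (cases p)
    show ?thesis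
    proof (cases "\<bar>pos i\<bar> \<le> L + 1 \<and> \<bar>pos j\<bar> \<le> L + 1")
      case True
      have "agree 1 (shift (pos i, pos j) (w (blk i, blk j))) (shift p glued)"
        unfolding agree_def shift_def p
        using True by (simp add: g inside_step)
      moreover have "local_rule (shift (pos i, pos j) (w (blk i, blk j)))"
        using w by (simp add: islands_def)
      ultimately show ?thesis
        by (rule local_rule_agree)
    next
      case False
      then have "\<bar>pos (i + a)\<bar> > L \<or> \<bar>pos (j + b)\<bar> > L" if "\<bar>a\<bar> \<le> 1" "\<bar>b\<bar> \<le> 1" for a b
        using boundary_step[of i a] boundary_step[of j b] that by auto
      then have "agree 1 (shift p (flat (\<lambda>t. V (pos t)))) (shift p glued)"
        unfolding agree_def shift_def p by (simp add: g w_out flat_apply)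
      moreover have "local_rule (shift p (flat (\<lambda>t. V (pos t))))"
        using conf_in_islands[OF valid_flat] unfolding islands_def by blast
      ultimately show ?thesis
        by (rule local_rule_agree)
    qed
  qed
  ultimately show ?thesis
    by (auto simp: islands_def)
qed

lemma glued_block:
  assumes "\<bar>i\<bar> \<le> L" "\<bar>j\<bar> \<le> L"
  shows "shift (N * a, N * b) glued (i, j) = (if \<phi> (a, b) then x1 else x2) (i, j)"
  using assms blk_pos_unique[of i a] blk_pos_unique[of j b] by (simp add: glued_def shift_def)

end

text \<open>The approximating point is background outside a box, so its islands can be kept or
  erased independently in each block of a lattice; windows of \<open>x\<close> and of
  \<open>flat V\<close> thus occur in every pattern.\<close>

lemma E1_flatI:
  assumes x: "x \<in> islands"
    and approx: "\<And>m :: nat. \<exists>x' V' L. x' \<in> islands \<and> agree m x x' \<and>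
      (\<forall>i j. \<bar>i\<bar> > L \<or> \<bar>j\<bar> > L \<longrightarrow> x' (i, j) = of_bool (V' i)) \<and> (\<forall>i. \<bar>i\<bar> \<le> int m \<longrightarrow> V' i = V i)"
  shows "(x, flat V) \<in> E1 islands"
proof -
  have f: "flat V \<in> islands"
    by (rule conf_in_islands[OF valid_flat])
  have "cover_entropy islands {islands - K, islands - K'} > 0"
    if K: "closed_nbhd islands x K" "closed_nbhd islands (flat V) K'" "K \<inter> K' = {}" for K K'
  proof -
    obtain m1 where m1: "\<And>y. y \<in> islands \<Longrightarrow> agree m1 x y \<Longrightarrow> y \<in> K"
      using closed_nbhdE[OF K(1)] by metis
    obtain m2 where m2: "\<And>y. y \<in> islands \<Longrightarrow> agree m2 (flat V) y \<Longrightarrow> y \<in> K'"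
      using closed_nbhdE[OF K(2)] by metis
    define m where "m = max m1 m2"
    obtain x' V' L where x': "x' \<in> islands" "agree m x x'"
      "\<And>i j. \<bar>i\<bar> > L \<or> \<bar>j\<bar> > L \<Longrightarrow> x' (i, j) = of_bool (V' i)" "\<And>i. \<bar>i\<bar> \<le> int m \<Longrightarrow> V' i = V i"
      using approx[of m] by blast
    \<comment> \<open>A block must contain both the islands of \<open>x'\<close> and the window of
      radius \<open>m\<close>.\<close>
    define M where "M = max L (int m)"
    have glue: "gluing M x' (flat V') V'"
    proof
      show "M \<ge> 0"
        by (simp add: M_def)
      show "x' \<in> islands"
        by (rule x'(1))
      show "flat V' \<in> islands"
        by (rule conf_in_islands[OF valid_flat])
      show "x' (i, j) = of_bool (V' i)" if "\<bar>i\<bar> > M \<or> \<bar>j\<bar> > M" for i j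
        by (rule x'(3)) (use that in \<open>auto simp: M_def\<close>)
    qed (simp add: flat_apply)
    define N where "N = nat (gluing.N M)"
    have N: "gluing.N M = int N" "N \<ge> 1"
      unfolding N_def gluing.N_def[OF glue] unfolding M_def by simp_all
    show ?thesis
    proof (rule entropy_pos_if_independent[OF shift_islands K(3) N(2)])
      fix \<phi> :: "int \<times> int \<Rightarrow> bool"
      let ?z = "gluing.glued M x' (flat V') \<phi>"
      have z: "?z \<in> islands"
        by (rule gluing.glued_in_islands[OF glue])
      have block: "agree m (if \<phi> (a, b) then x' else flat V') (shift (int N * a, int N * b) ?z)" for a b
        unfolding agree_def
      proof (intro allI impI)
        fix i j assume "\<bar>i\<bar> \<le> int m \<and> \<bar>j\<bar> \<le> int m"
        then have "\<bar>i\<bar> \<le> M" "\<bar>j\<bar> \<le> M"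
          by (auto simp: M_def)
        from gluing.glued_block[OF glue this, of a b \<phi>]
        show "(if \<phi> (a, b) then x' else flat V') (i, j) = shift (int N * a, int N * b) ?z (i, j)"
          unfolding N(1) by (rule sym)
      qed
      have "shift (int N * a, int N * b) ?z \<in> (if \<phi> (a, b) then K else K')" for a b
      proof (cases "\<phi> (a, b)")
        case True
        then have "agree m x (shift (int N * a, int N * b) ?z)"
          using block[of a b] x'(2) agree_trans by simp
        then have "agree m1 x (shift (int N * a, int N * b) ?z)"
          unfolding m_def by (rule agree_maxD(1))
        then show ?thesis
          using True m1[OF shift_islands[OF z]] by simp
      next
        case False
        have "agree m (flat V) (flat V')"
          using x'(4) by (simp add: agree_def flat_apply)
        then have "agree m (flat V) (shift (int N * a, int N * b) ?z)"
          using block[of a b] False agree_trans by simp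
        then have "agree m2 (flat V) (shift (int N * a, int N * b) ?z)"
          unfolding m_def by (rule agree_maxD(2))
        then show ?thesis
          using False m2[OF shift_islands[OF z]] by simp
      qed
      then show "\<exists>z\<in>islands. \<forall>a b. shift (int N * a, int N * b) z \<in> (if \<phi> (a, b) then K else K')"
        using z by blast
    qed
  qed
  then show ?thesis
    using x f by (auto simp: E1_def entropy_pair_def)
qed

section \<open>Entropy pairs and the TCPE rank\<close>

text \<open>
  Only the case that row 0 of \<open>x\<close> is a single run can produce an error. Then a point that agrees
  with \<open>x\<close> near the origin has all of \<open>C\<close> in one run, which has at most one middle.
\<close>

lemma outer_determined:
  assumes x: "x \<in> islands" and C: "finite C"
  obtains m where "\<And>z. z \<in> islands \<Longrightarrow> agree m x z \<Longrightarrow> card {c \<in> C. outer z c \<noteq> outer x c} \<le> 1"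
proof (cases "\<forall>i. sh x i 0 = sh x 0 0")
  case True
  \<comment> \<open>A constant row has no run with two ends.\<close>
  then have not_central: "\<not> central (sh x) c 0" for c
    unfolding central_def by metis
  obtain B where B: "\<And>c. c \<in> C \<Longrightarrow> \<bar>c\<bar> \<le> B"
    using bdd_above_finite[OF finite_imageI[OF C, of abs]] unfolding bdd_above_def by blast
  have "card {c \<in> C. outer z c \<noteq> outer x c} \<le> 1" if z: "z \<in> islands" "agree (nat B) x z" for z
  proof -
    have row: "z (i, 0) = x (i, 0)" if "\<bar>i\<bar> \<le> B" for i
    proof -
      have "\<bar>i\<bar> \<le> int (nat B)"
        using that by linarith
      then show ?thesis
        using agreeD[OF z(2), of i 0] by (simp del: int_nat_eq)
    qed
    have cen: "central (sh z) c 0" if "c \<in> C" "outer z c \<noteq> outer x c" for c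
      using that row[OF B] not_central[of c] by (auto simp: outer_def bt_def)
    have const: "sh z i 0 = sh x 0 0" if "\<bar>i\<bar> \<le> B" for i
      using row[OF that] True by (auto simp: sh_def)
    have "c = c'" if "c \<in> C" "outer z c \<noteq> outer x c" "c' \<in> C" "outer z c' \<noteq> outer x c'" "c \<le> c'" for c c'
    proof (rule central_unique[OF cen[OF that(1,2)] cen[OF that(3,4)] that(5)])
      fix i assume "c \<le> i" "i \<le> c'"
      then have "\<bar>i\<bar> \<le> B"
        using B[OF that(1)] B[OF that(3)] by linarith
      then show "sh z i 0 = sh x 0 0"
        by (rule const)
    qed
    then have "c = c'" if "c \<in> C" "outer z c \<noteq> outer x c" "c' \<in> C" "outer z c' \<noteq> outer x c'" for c c'
      using that by (metis linear)
    then show ?thesis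
      using C by (simp add: card_le_Suc0_iff_eq)
  qed
  then show ?thesis
    using that by blast
next
  case False
  then have "\<exists>i. sh x i 0 \<noteq> sh x c 0" for c
    by metis
  then obtain e where e: "\<And>c. sh x (e c) 0 \<noteq> sh x c 0"
    by metis
  \<comment> \<open>The window reaches from \<open>c\<close>, on both sides, as far as the cell
    \<open>e c\<close> of another value.\<close>
  obtain B where B: "\<And>c. c \<in> C \<Longrightarrow> \<bar>c\<bar> + \<bar>e c - c\<bar> \<le> B"
    using bdd_above_finite[OF finite_imageI[OF C, of "\<lambda>c. \<bar>c\<bar> + \<bar>e c - c\<bar>"]] unfolding bdd_above_def by blast
  have "card {c \<in> C. outer z c \<noteq> outer x c} \<le> 1" if z: "z \<in> islands" "agree (nat B) x z" for z
  proof -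
    have row: "z (i, 0) = x (i, 0)" if "\<bar>i\<bar> \<le> B" for i
    proof -
      have "\<bar>i\<bar> \<le> int (nat B)"
        using that by linarith
      then show ?thesis
        using agreeD[OF z(2), of i 0] by (simp del: int_nat_eq)
    qed
    have "outer z c = outer x c" if c: "c \<in> C" for c
    proof -
      have "central (sh x) c 0 \<longleftrightarrow> central (sh z) c 0"
      proof (rule central_determined[where i = "e c" and n = "\<bar>e c - c\<bar>"])
        fix l assume "\<bar>l - c\<bar> \<le> \<bar>e c - c\<bar>"
        then have "\<bar>l\<bar> \<le> B"
          using B[OF c] by linarith
        then show "sh x l 0 = sh z l 0"
          using row[of l] by (simp add: sh_def)
      qed (use e in auto)
      moreover have "\<bar>c\<bar> \<le> B"
        using B[OF c] by linarith
      ultimately show ?thesis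
        using row[of c] by (simp add: outer_def bt_def)
    qed
    then have e: "{c \<in> C. outer z c \<noteq> outer x c} = {}"
      by blast
    show ?thesis
      unfolding e by simp
  qed
  then show ?thesis
    using that by blast
qed

lemma E1_outer_finite:
  assumes "(x, y) \<in> E1 islands"
  shows "finite {c. outer x c \<noteq> outer y c}"
proof (rule ccontr)
  assume inf: "\<not> ?thesis"
  have X: "x \<in> islands" "y \<in> islands"
    using assms by (auto simp: E1_def)
  \<comment> \<open>Three columns: one error against \<open>x\<close> and one against
    \<open>y\<close> leave a column of \<open>C\<close> in which \<open>x\<close> and
    \<open>y\<close> would agree.\<close>
  obtain C where C: "C \<subseteq> {c. outer x c \<noteq> outer y c}" "finite C" "card C = 3"
    using infinite_arbitrarily_large[OF inf] by blast
  have False if a: "card {c \<in> C. W c \<noteq> outer x c} \<le> 1" "card {c \<in> C. W c \<noteq> outer y c} \<le> 1" for W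
  proof -
    have "C \<subseteq> {c \<in> C. W c \<noteq> outer x c} \<union> {c \<in> C. W c \<noteq> outer y c}"
      using C(1) by blast
    then have "card C \<le> card ({c \<in> C. W c \<noteq> outer x c} \<union> {c \<in> C. W c \<noteq> outer y c})"
      using C(2) by (intro card_mono) auto
    also have "\<dots> \<le> card {c \<in> C. W c \<noteq> outer x c} + card {c \<in> C. W c \<noteq> outer y c}"
      by (rule card_Un_le)
    finally show False
      using a C(3) by linarith
  qed
  note conflict = this
  obtain m1 where m1: "\<And>z. z \<in> islands \<Longrightarrow> agree m1 x z \<Longrightarrow> card {c \<in> C. outer z c \<noteq> outer x c} \<le> 1"
    using outer_determined[OF X(1) C(2)] by metis
  obtain m2 where m2: "\<And>z. z \<in> islands \<Longrightarrow> agree m2 y z \<Longrightarrow> card {c \<in> C. outer z c \<noteq> outer y c} \<le> 1"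
    using outer_determined[OF X(2) C(2)] by metis
  define K where "K = {z \<in> islands. agree m1 x z}"
  define L where "L = {z \<in> islands. agree m2 y z}"
  \<comment> \<open>Both windows lie over the same column \<open>i\<close>, so by
    \<open>outer_shift\<close> they compare the same function, \<open>outer z\<close> translated by
    \<open>i\<close>, with \<open>outer x\<close> and \<open>outer y\<close>.\<close>
  have excl: False if z: "z \<in> islands" "shift (i, j) z \<in> K" "shift (i, j') z \<in> L" for z i j j'
  proof -
    have "card {c \<in> C. outer z (i + c) \<noteq> outer x c} \<le> 1" "card {c \<in> C. outer z (i + c) \<noteq> outer y c} \<le> 1"
      using m1[of "shift (i, j) z"] m2[of "shift (i, j') z"] z(2,3) outer_shift[OF z(1)]
      by (simp_all add: K_def L_def)
    then show False
      by (rule conflict)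
  qed
  have "K \<inter> L = {}"
    using conflict m1 m2 unfolding K_def L_def by blast
  moreover have "closed_nbhd islands x K" "closed_nbhd islands y L"
    unfolding K_def L_def by (rule closed_nbhd_agree[OF X(1)], rule closed_nbhd_agree[OF X(2)])
  moreover have "x \<noteq> y"
    using inf by auto
  ultimately have "cover_entropy islands {islands - K, islands - L} > 0"
    using assms by (auto simp: E1_def entropy_pair_def)
  moreover have "cover_entropy islands {islands - K, islands - L} = 0"
    by (rule entropy_zero_if_column_exclusive[OF shift_islands _ excl]) (use X in auto)
  ultimately show False
    by simp
qed

section \<open>The equivalence relation generated by \<open>E1\<close>\<close>

definition related :: "nat config rel" where
  "related = (E1 islands \<union> (E1 islands)\<inverse>)\<^sup>+"

lemma related_sym: "(x, y) \<in> related \<Longrightarrow> (y, x) \<in> related"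
  using sym_trancl[of "E1 islands \<union> (E1 islands)\<inverse>"] unfolding related_def
  by (auto simp: sym_def)

lemma related_trans: "(x, y) \<in> related \<Longrightarrow> (y, z) \<in> related \<Longrightarrow> (x, z) \<in> related"
  unfolding related_def by (rule trancl_trans)

lemma E1_related: "(x, y) \<in> E1 islands \<Longrightarrow> (x, y) \<in> related"
  unfolding related_def by blast

lemma related_outer_finite:
  assumes "(x, y) \<in> related"
  shows "finite {c. outer x c \<noteq> outer y c}"
  using assms unfolding related_def
proof (induction rule: trancl_induct)
  case (base y)
  then show ?case
    using E1_outer_finite[of x y] E1_outer_finite[of y x] by (auto simp: eq_commute)
next
  case (step y z)
  have "finite {c. outer y c \<noteq> outer z c}"
    using step.hyps E1_outer_finite[of y z] E1_outer_finite[of z y] by (auto simp: eq_commute)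
  then have "finite ({c. outer x c \<noteq> outer y c} \<union> {c. outer y c \<noteq> outer z c})"
    using step.IH by blast
  then show ?case
    by (rule rev_finite_subset) auto
qed

lemma related_proper: "related \<noteq> islands \<times> islands"
proof
  assume e: "related = islands \<times> islands"
  have "(flat (\<lambda>_. False), flat (\<lambda>_. True)) \<in> related"
    unfolding e using conf_in_islands[OF valid_flat] by blast
  from related_outer_finite[OF this] show False
    by (simp add: outer_conf infinite_UNIV_int)
qed

lemma valid_up: "valid (\<lambda>_ _. up)"
  by (rule validI) (auto simp: triple_def)

text \<open>The window is covered by the upper half of a large diamond centred at column
  \<open>c\<close>, which toggles \<open>V\<close> at \<open>c\<close> while the shape shows only
  \<open>up\<close>. The column may change with \<open>m\<close> and may lie outside the
  window.\<close>

lemma E1_up_flat: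
  assumes toggled: "\<And>m :: nat. \<exists>c. \<forall>i. \<bar>i\<bar> \<le> int m \<longrightarrow> (V i \<noteq> (i = c)) = W i"
  shows "(conf (\<lambda>_ _. up) W, flat V) \<in> E1 islands"
proof (rule E1_flatI)
  show "conf (\<lambda>_ _. up) W \<in> islands"
    by (rule conf_in_islands[OF valid_up])
  fix m :: nat
  obtain c where c: "\<And>i. \<bar>i\<bar> \<le> int m \<Longrightarrow> (V i \<noteq> (i = c)) = W i"
    using toggled[of m] by blast
  \<comment> \<open>The diagonal lies just below the window, and \<open>r\<close> is the largest
    distance from the centre \<open>(c, - int m - 1)\<close> to a cell of the window.\<close>
  define r where "r = \<bar>c\<bar> + 3 * int m + 1"
  define d where "d = diamond c (- int m - 1) r"
  have "agree m (conf (\<lambda>_ _. up) W) (conf d V)"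
    unfolding agree_def
  proof (intro allI impI)
    fix i j assume ij: "\<bar>i\<bar> \<le> int m \<and> \<bar>j\<bar> \<le> int m"
    have "\<bar>i - c\<bar> + \<bar>j - (- int m - 1)\<bar> \<le> r" "- int m - 1 < j"
      using ij unfolding r_def by linarith+
    then have "d i j = up" "central d i j \<longleftrightarrow> i = c"
      by (auto simp: d_def diamond_def central_diamond)
    moreover have "\<not> central (\<lambda>_ _. up) i j"
      by (simp add: central_def)
    ultimately show "conf (\<lambda>_ _. up) W (i, j) = conf d V (i, j)"
      using c[of i] ij by (simp add: conf_def)
  qed
  moreover have "conf d V \<in> islands"
    unfolding d_def by (rule conf_in_islands[OF valid_diamond])
  moreover have "conf d V (i, j) = of_bool (V i)"
    if "\<bar>i\<bar> > \<bar>c\<bar> + r + int m + 1 \<or> \<bar>j\<bar> > \<bar>c\<bar> + r + int m + 1" for i j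
  proof (rule conf_outside[OF _ that])
    fix i j assume "d i j \<noteq> grey"
    then have "\<bar>i - c\<bar> + \<bar>j - (- int m - 1)\<bar> \<le> r"
      by (auto simp: d_def diamond_def split: if_splits)
    then show "\<bar>i\<bar> \<le> \<bar>c\<bar> + r + int m + 1 \<and> \<bar>j\<bar> \<le> \<bar>c\<bar> + r + int m + 1"
      by linarith
  qed
  ultimately show "\<exists>x' V' L. x' \<in> islands \<and> agree m (conf (\<lambda>_ _. up) W) x' \<and>
      (\<forall>i j. \<bar>i\<bar> > L \<or> \<bar>j\<bar> > L \<longrightarrow> x' (i, j) = of_bool (V' i)) \<and> (\<forall>i. \<bar>i\<bar> \<le> int m \<longrightarrow> V' i = V i)"
    by (intro exI[of _ "conf d V"] exI[of _ V] exI[of _ "\<bar>c\<bar> + r + int m + 1"]) auto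
qed

text \<open>The plane of \<open>up\<close> cells with bits \<open>V'\<close> is the link: it is
  paired with \<open>flat V\<close> by diamonds centred at \<open>c\<close>, and with
  \<open>flat V'\<close> by diamonds centred outside the window.\<close>

lemma flat_toggle_related:
  assumes "\<And>i. V' i = (V i \<noteq> (i = c))"
  shows "(flat V', flat V) \<in> related"
proof -
  have "(conf (\<lambda>_ _. up) V', flat V) \<in> E1 islands"
    by (rule E1_up_flat) (use assms in blast)
  moreover have "(conf (\<lambda>_ _. up) V', flat V') \<in> E1 islands"
  proof (rule E1_up_flat)
    show "\<exists>c. \<forall>i. \<bar>i\<bar> \<le> int m \<longrightarrow> (V' i \<noteq> (i = c)) = V' i" for m :: nat
      by (rule exI[of _ "int m + 1"]) auto
  qed
  ultimately show ?thesis
    using E1_related related_sym related_trans by blast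
qed

lemma flat_finite_related:
  assumes "finite S"
  shows "(flat (\<lambda>i. i \<in> S), flat (\<lambda>_. False)) \<in> related"
  using assms
proof (induction S rule: finite_induct)
  case empty
  have "(flat (\<lambda>_. False), flat (\<lambda>_. False)) \<in> E1 islands"
    by (simp add: E1_def conf_in_islands[OF valid_flat])
  then show ?case
    using E1_related by simp
next
  case (insert c S)
  have "(flat (\<lambda>i. i \<in> insert c S), flat (\<lambda>i. i \<in> S)) \<in> related"
    by (rule flat_toggle_related[where c = c]) (use insert.hyps in auto)
  then show ?case
    using insert.IH related_trans by blast
qed

lemma finite_approximation:
  assumes x: "x \<in> islands"
  obtains x' where "agree m x x'" "(x', flat (\<lambda>_. False)) \<in> related"
proof -
  \<comment> \<open>One cell of margin, because an apex is recognised by its horizontal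
    neighbours.\<close>
  obtain s L where s: "valid s" "\<And>i j. \<bar>i\<bar> \<le> int m + 1 \<Longrightarrow> \<bar>j\<bar> \<le> int m + 1 \<Longrightarrow> s i j = sh x i j"
    "\<And>i j. s i j \<noteq> grey \<Longrightarrow> \<bar>i\<bar> \<le> L \<and> \<bar>j\<bar> \<le> L"
    using finite_truncation[OF islands_valid[OF x], of "int m + 1"] by metis
  \<comment> \<open>Truncation may move the middle of an island, so \<open>V\<close> is not read off
    from \<open>outer x\<close> but fitted to the bits of \<open>x\<close> in row 0 relative to the
    truncated shape. The other rows follow because both points have the same apexes in the
    window.\<close>
  define S where "S = {i. \<bar>i\<bar> \<le> int m \<and> bt x i 0 \<noteq> central s i 0}"
  define V where "V = (\<lambda>i. i \<in> S)"
  have "finite S"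
    by (rule finite_subset[of _ "{- int m..int m}"]) (auto simp: S_def)
  then have fin: "(flat V, flat (\<lambda>_. False)) \<in> related"
    using flat_finite_related by (simp add: V_def)
  have bits: "bt x i j = bt (conf s V) i j" if i: "\<bar>i\<bar> \<le> int m" and j: "\<bar>j\<bar> \<le> int m" for i j
  proof -
    let ?eq = "\<lambda>j. bt x i j = bt (conf s V) i j"
    have step: "?eq j \<longleftrightarrow> ?eq (j + 1)" if "- int m \<le> j" "j < int m" for j
    proof -
      have a: "s l k = sh x l k" if "l = i - 1 \<or> l = i \<or> l = i + 1" "k = j \<or> k = j + 1" for l k
        using s(2)[of l k] that i \<open>- int m \<le> j\<close> \<open>j < int m\<close> by auto
      have "top_apex s i j \<longleftrightarrow> top_apex (sh x) i j" "bottom_apex s i (j + 1) \<longleftrightarrow> bottom_apex (sh x) i (j + 1)"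
        by (simp_all add: top_apex_def bottom_apex_def a)
      moreover have "(bt z i j \<noteq> bt z i (j + 1)) \<longleftrightarrow> top_apex (sh z) i j \<or> bottom_apex (sh z) i (j + 1)"
        if "z \<in> islands" for z
        using that local_rule_shift[of i j z] by (auto simp: islands_def)
      from this[OF x] this[OF conf_in_islands[OF s(1)], of V] calculation
      show ?thesis
        unfolding sh_conf by blast
    qed
    have "n \<le> m \<longrightarrow> ?eq (int n) \<and> ?eq (- int n)" for n
    proof (induction n)
      case 0
      then show ?case
        using i by (auto simp: V_def S_def)
    next
      case (Suc n)
      then show ?case
        using step[of "int n"] step[of "- int (Suc n)"] by (auto simp: add.commute)
    qed
    from this[of "nat \<bar>j\<bar>"] j show ?thesis
      by (cases "j \<ge> 0") auto
  qed
  have "agree m x (conf s V)"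
    unfolding agree_def
  proof (intro allI impI)
    fix i j assume ij: "\<bar>i\<bar> \<le> int m \<and> \<bar>j\<bar> \<le> int m"
    then have "sh x i j = sh (conf s V) i j"
      using s(2)[of i j] by simp
    moreover have "bt x i j = bt (conf s V) i j"
      using bits ij by blast
    moreover have "a = b" if "a div 2 = b div 2" "odd a = odd b" for a b :: nat
      using that by presburger
    ultimately show "x (i, j) = conf s V (i, j)"
      unfolding sh_def bt_def by blast
  qed
  moreover have "(conf s V, flat V) \<in> E1 islands"
  proof (rule E1_flatI)
    show "conf s V \<in> islands"
      by (rule conf_in_islands[OF s(1)])
    then show "\<exists>x' V' L. x' \<in> islands \<and> agree m (conf s V) x' \<and>
        (\<forall>i j. \<bar>i\<bar> > L \<or> \<bar>j\<bar> > L \<longrightarrow> x' (i, j) = of_bool (V' i)) \<and> (\<forall>i. \<bar>i\<bar> \<le> int m \<longrightarrow> V' i = V i)" for m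
      using conf_outside[of s L, OF s(3)]
      by (intro exI[of _ "conf s V"] exI[of _ V] exI[of _ L]) (auto simp: agree_refl)
  qed
  ultimately show ?thesis
    using that fin E1_related related_trans by blast
qed

theorem theorem9:
  shows "\<exists>(A :: nat set) X. sft A X \<and> has_tcpe_rank X (3::nat)"
proof (intro exI conjI)
  show "sft {0..<8} islands"
    by (rule sft_islands)
  show "has_tcpe_rank islands (3::nat)"
  proof (rule rank_three_if_dense_proper[OF closed_islands])
    fix x y m assume xy: "x \<in> islands" "y \<in> islands"
    obtain x' where x': "agree m x x'" "(x', flat (\<lambda>_. False)) \<in> related"
      using finite_approximation[OF xy(1)] .
    obtain y' where y': "agree m y y'" "(y', flat (\<lambda>_. False)) \<in> related"
      using finite_approximation[OF xy(2)] .
    have "(x', y') \<in> related"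
      using x'(2) y'(2) related_sym related_trans by blast
    then show "\<exists>(x', y')\<in>(E1 islands \<union> (E1 islands)\<inverse>)\<^sup>+. agree m x x' \<and> agree m y y'"
      using x'(1) y'(1) unfolding related_def by blast
  next
    show "(E1 islands \<union> (E1 islands)\<inverse>)\<^sup>+ \<noteq> islands \<times> islands"
      using related_proper by (simp add: related_def)
  qed
qed

end
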